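(* For any matrix $\mathsf{M}$ in $\mathsf{matr}$, either $\mathsf{M}\Rightarrow_{\mathsf{reg}}\mathsf{Mal}$ or $\mathsf{Maj}\Rightarrow_{\mathsf{reg}}\mathsf{M}$, and these two implications cannot occur simultaneously.
   Context: Regular categories. A category is regular if it is finitely complete, has coequalisers of kernel pairs, and regular epimorphisms are stable under pullbacks. Matrices. For integers $n,k>0$ and $m\geqslant 0$, $\mathsf{matr}(n,m,k)$ is the set of matrices with $n$ rows and $m+1$ columns with entries in the set of variables $\{x_1,\dots,x_k\}$; $\mathsf{matr}$ is the union of all these sets. The last column is called the right column and the $m$ first columns are the left columns. A row-wise interpretation of $\mathsf{M}\in\mathsf{matr}(n,m,k)$ of type $(A_1,\dots,A_n)$ (where the $A_i$ are sets) is a matrix obtained from $\mathsf{M}$ by applying, for each $i$, a function $f_i\colon\{x_1,\dots,x_k\}\to A_i$ to all entries of the $i$-th row (including the entry in the right column). Factorisation. For morphisms $f,g$ with the same codomain in a category, $f\sqsubset g$ means that $f$ factors through $g$. Matrix property. A finitely complete category $\mathbb{C}$ has $\mathsf{M}$-closed relations (or satisfies the matrix property $\mathsf{M}$), for $\mathsf{M}\in\mathsf{matr}(n,m,k)$, if for all objects $X_1,\dots,X_n,S$, every monomorphism $r\colon R\rightarrowtail X_1\times\cdots\times X_n$ and every row-wise interpretation of $\mathsf{M}$ of type $(\hom(S,X_1),\dots,\hom(S,X_n))$ with left columns $c_1,\dots,c_m$ and right column $y$ (viewed as morphisms $S\to X_1\times\cdots\times X_n$): if $c_l\sqsubset r$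 for every $l\in\{1,\dots,m\}$, then $y\sqsubset r$. Implication. For $\mathsf{M},\mathsf{N}\in\mathsf{matr}$ (possibly of different sizes), $\mathsf{M}\Rightarrow_{\mathsf{reg}}\mathsf{N}$ means that every regular category with $\mathsf{M}$-closed relations has $\mathsf{N}$-closed relations. The Mal'tsev and majority matrices: $$\mathsf{Mal}=\left[\begin{array}{ccc|c} x_1&x_2&x_2&x_1\\ x_2&x_2&x_1&x_1\end{array}\right],\qquad \mathsf{Maj}=\left[\begin{array}{ccc|c} x_1&x_1&x_2&x_1\\ x_1&x_2&x_1&x_1\\ x_2&x_1&x_1&x_1\end{array}\right].$$ *)

theory Defs
  imports "Jordan_Normal_Form.Matrix" "HOL-Library.Infinite_Typeclass"
begin

section \<open>Categories\<close>

text \<open>Objects and arrows are the elements of the two carrier sets; the values of the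
  operations outside the carriers are irrelevant.  \<open>Comp C g f\<close> is \<open>g\<close> after \<open>f\<close>.\<close>

record ('o, 'a) cat =
  Obj :: "'o set"
  Arr :: "'a set"
  Dom :: "'a \<Rightarrow> 'o"
  Cod :: "'a \<Rightarrow> 'o"
  Ident :: "'o \<Rightarrow> 'a"
  Comp :: "'a \<Rightarrow> 'a \<Rightarrow> 'a"

definition hom :: "('o, 'a) cat \<Rightarrow> 'o \<Rightarrow> 'o \<Rightarrow> 'a set" where
  "hom C A B = {f \<in> Arr C. Dom C f = A \<and> Cod C f = B}"

locale category =
  fixes C :: "('o, 'a) cat"
  assumes dom_obj: "f \<in> Arr C \<Longrightarrow> Dom C f \<in> Obj C"
    and cod_obj: "f \<in> Arr C \<Longrightarrow> Cod C f \<in> Obj C"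
    and ident_hom: "A \<in> Obj C \<Longrightarrow> Ident C A \<in> hom C A A"
    and comp_hom: "f \<in> hom C A B \<Longrightarrow> g \<in> hom C B D \<Longrightarrow> Comp C g f \<in> hom C A D"
    and comp_ident_right: "f \<in> hom C A B \<Longrightarrow> Comp C f (Ident C A) = f"
    and comp_ident_left: "f \<in> hom C A B \<Longrightarrow> Comp C (Ident C B) f = f"
    and comp_assoc: "f \<in> hom C A B \<Longrightarrow> g \<in> hom C B D \<Longrightarrow> h \<in> hom C D E \<Longrightarrow>
      Comp C (Comp C h g) f = Comp C h (Comp C g f)"

definition factors_through :: "('o, 'a) cat \<Rightarrow> 'a \<Rightarrow> 'a \<Rightarrow> bool" where
  "factors_through C f g \<longleftrightarrow> f \<in> Arr C \<and> g \<in> Arr C \<and> Cod C f = Cod C g \<and>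
     (\<exists>h \<in> hom C (Dom C f) (Dom C g). Comp C g h = f)"

definition monic :: "('o, 'a) cat \<Rightarrow> 'a \<Rightarrow> bool" where
  "monic C r \<longleftrightarrow> r \<in> Arr C \<and>
     (\<forall>T. \<forall>f \<in> hom C T (Dom C r). \<forall>g \<in> hom C T (Dom C r).
        Comp C r f = Comp C r g \<longrightarrow> f = g)"

section \<open>Finite limits\<close>

definition is_functor ::
  "('p, 'b) cat \<Rightarrow> ('o, 'a) cat \<Rightarrow> ('p \<Rightarrow> 'o) \<Rightarrow> ('b \<Rightarrow> 'a) \<Rightarrow> bool" where
  "is_functor J C Fo Fa \<longleftrightarrow>
     (\<forall>j \<in> Obj J. Fo j \<in> Obj C) \<and>
     (\<forall>u \<in> Arr J. Fa u \<in> hom C (Fo (Dom J u)) (Fo (Cod J u))) \<and>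
     (\<forall>j \<in> Obj J. Fa (Ident J j) = Ident C (Fo j)) \<and>
     (\<forall>u \<in> Arr J. \<forall>v \<in> Arr J. Cod J u = Dom J v \<longrightarrow>
        Fa (Comp J v u) = Comp C (Fa v) (Fa u))"

definition is_cone ::
  "('p, 'b) cat \<Rightarrow> ('o, 'a) cat \<Rightarrow> ('p \<Rightarrow> 'o) \<Rightarrow> ('b \<Rightarrow> 'a) \<Rightarrow> 'o \<Rightarrow> ('p \<Rightarrow> 'a) \<Rightarrow> bool" where
  "is_cone J C Fo Fa L p \<longleftrightarrow> L \<in> Obj C \<and>
     (\<forall>j \<in> Obj J. p j \<in> hom C L (Fo j)) \<and>
     (\<forall>u \<in> Arr J. Comp C (Fa u) (p (Dom J u)) = p (Cod J u))"

definition is_limit ::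
  "('p, 'b) cat \<Rightarrow> ('o, 'a) cat \<Rightarrow> ('p \<Rightarrow> 'o) \<Rightarrow> ('b \<Rightarrow> 'a) \<Rightarrow> 'o \<Rightarrow> ('p \<Rightarrow> 'a) \<Rightarrow> bool" where
  "is_limit J C Fo Fa L p \<longleftrightarrow> is_cone J C Fo Fa L p \<and>
     (\<forall>T t. is_cone J C Fo Fa T t \<longrightarrow>
        (\<exists>!h. h \<in> hom C T L \<and> (\<forall>j \<in> Obj J. Comp C (p j) h = t j)))"

text \<open>Every finite category is isomorphic to one whose objects and arrows are natural
  numbers, so these suffice as index categories.\<close>

definition finitely_complete :: "('o, 'a) cat \<Rightarrow> bool" where
  "finitely_complete C \<longleftrightarrow> category C \<and>
     (\<forall>(J :: (nat, nat) cat) Fo Fa.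
        category J \<and> finite (Obj J) \<and> finite (Arr J) \<and> is_functor J C Fo Fa \<longrightarrow>
        (\<exists>L p. is_limit J C Fo Fa L p))"

definition is_product ::
  "('o, 'a) cat \<Rightarrow> nat \<Rightarrow> (nat \<Rightarrow> 'o) \<Rightarrow> 'o \<Rightarrow> (nat \<Rightarrow> 'a) \<Rightarrow> bool" where
  "is_product C n X P p \<longleftrightarrow> P \<in> Obj C \<and> (\<forall>i<n. p i \<in> hom C P (X i)) \<and>
     (\<forall>T \<in> Obj C. \<forall>t. (\<forall>i<n. t i \<in> hom C T (X i)) \<longrightarrow>
        (\<exists>!h. h \<in> hom C T P \<and> (\<forall>i<n. Comp C (p i) h = t i)))"

text \<open>The morphism into the product \<open>(P, p)\<close> with components \<open>t 0, \<dots>, t (n - 1)\<close>.\<close>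

definition tuple ::
  "('o, 'a) cat \<Rightarrow> nat \<Rightarrow> 'o \<Rightarrow> (nat \<Rightarrow> 'a) \<Rightarrow> 'o \<Rightarrow> (nat \<Rightarrow> 'a) \<Rightarrow> 'a" where
  "tuple C n P p T t = (THE h. h \<in> hom C T P \<and> (\<forall>i<n. Comp C (p i) h = t i))"

section \<open>Regular categories\<close>

text \<open>\<open>is_pullback C f g p q\<close>: the square \<open>f p = g q\<close> is a pullback.\<close>

definition is_pullback :: "('o, 'a) cat \<Rightarrow> 'a \<Rightarrow> 'a \<Rightarrow> 'a \<Rightarrow> 'a \<Rightarrow> bool" where
  "is_pullback C f g p q \<longleftrightarrow>
     f \<in> Arr C \<and> g \<in> Arr C \<and> Cod C f = Cod C g \<and>
     p \<in> Arr C \<and> q \<in> Arr C \<and> Dom C p = Dom C q \<and>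
     Cod C p = Dom C f \<and> Cod C q = Dom C g \<and> Comp C f p = Comp C g q \<and>
     (\<forall>T. \<forall>a \<in> hom C T (Dom C f). \<forall>b \<in> hom C T (Dom C g). Comp C f a = Comp C g b \<longrightarrow>
        (\<exists>!h. h \<in> hom C T (Dom C p) \<and> Comp C p h = a \<and> Comp C q h = b))"

definition is_kernel_pair :: "('o, 'a) cat \<Rightarrow> 'a \<Rightarrow> 'a \<Rightarrow> 'a \<Rightarrow> bool" where
  "is_kernel_pair C f p q \<longleftrightarrow> is_pullback C f f p q"

definition is_coequaliser :: "('o, 'a) cat \<Rightarrow> 'a \<Rightarrow> 'a \<Rightarrow> 'a \<Rightarrow> bool" where
  "is_coequaliser C f g q \<longleftrightarrow>
     f \<in> Arr C \<and> g \<in> Arr C \<and> Dom C f = Dom C g \<and> Cod C f = Cod C g \<and>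
     q \<in> Arr C \<and> Dom C q = Cod C f \<and> Comp C q f = Comp C q g \<and>
     (\<forall>T. \<forall>h \<in> hom C (Cod C f) T. Comp C h f = Comp C h g \<longrightarrow>
        (\<exists>!u. u \<in> hom C (Cod C q) T \<and> Comp C u q = h))"

definition regular_epi :: "('o, 'a) cat \<Rightarrow> 'a \<Rightarrow> bool" where
  "regular_epi C q \<longleftrightarrow> (\<exists>f g. is_coequaliser C f g q)"

definition regular_category :: "('o, 'a) cat \<Rightarrow> bool" where
  "regular_category C \<longleftrightarrow> finitely_complete C \<and>
     (\<forall>f p q. is_kernel_pair C f p q \<longrightarrow> (\<exists>e. is_coequaliser C p q e)) \<and>
     (\<forall>f g p q. is_pullback C f g p q \<and> regular_epi C f \<longrightarrow> regular_epi C q)"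

section \<open>Matrices and matrix properties\<close>

text \<open>The variable \<open>x\<^sub>v\<close> is represented by the number \<open>v\<close>.  Rows and columns are
  numbered from 0, so the left columns are those with index less than \<open>m\<close> and the right
  column has index \<open>m\<close>.\<close>

definition matr_nmk :: "nat \<Rightarrow> nat \<Rightarrow> nat \<Rightarrow> nat mat set" where
  "matr_nmk n m k = {M \<in> carrier_mat n (m + 1).
     n > 0 \<and> k > 0 \<and> (\<forall>i<n. \<forall>j\<le>m. M $$ (i, j) \<in> {1..k})}"

definition matr :: "nat mat set" where
  "matr = (\<Union>n m k. matr_nmk n m k)"

definition rowwise_interpretation ::
  "nat \<Rightarrow> nat \<Rightarrow> nat \<Rightarrow> nat mat \<Rightarrow> (nat \<Rightarrow> 'a set) \<Rightarrow> 'a mat \<Rightarrow> bool" where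
  "rowwise_interpretation n m k M A B \<longleftrightarrow>
     (\<exists>f. (\<forall>i<n. \<forall>v \<in> {1..k}. f i v \<in> A i) \<and>
          B = mat n (m + 1) (\<lambda>(i, j). f i (M $$ (i, j))))"

text \<open>A matrix belongs to \<open>matr_nmk n m k\<close> for all sufficiently large \<open>k\<close>, and the condition
  below does not depend on \<open>k\<close>, since every row of a matrix contains at least one entry.
  The product \<open>X\<^sub>1 \<times> \<dots> \<times> X\<^sub>n\<close> ranges over all products of the family.\<close>

definition closed_relations :: "('o, 'a) cat \<Rightarrow> nat mat \<Rightarrow> bool" where
  "closed_relations C M \<longleftrightarrow>
     (\<forall>n m k X S P p r B.
        M \<in> matr_nmk n m k \<and> (\<forall>i<n. X i \<in> Obj C) \<and> S \<in> Obj C \<and>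
        is_product C n X P p \<and> monic C r \<and> Cod C r = P \<and>
        rowwise_interpretation n m k M (\<lambda>i. hom C S (X i)) B \<and>
        (\<forall>l<m. factors_through C (tuple C n P p S (\<lambda>i. B $$ (i, l))) r) \<longrightarrow>
        factors_through C (tuple C n P p S (\<lambda>i. B $$ (i, m))) r)"

text \<open>A formula of HOL cannot quantify over types, so the types of objects and arrows of the
  categories under consideration are passed as a parameter.  They should be infinite for the
  relation to be meaningful: over one-element types, for instance, every regular category is
  trivial.  A statement about two implications should use independent type variables for
  them, since a disjunction \<open>P \<or> Q\<close> schematic in independent types for \<open>P\<close> and \<open>Q\<close> says that
  \<open>P\<close> holds for all types or \<open>Q\<close> holds for all types.\<close>

definition implies_reg :: "('o \<times> 'a) itself \<Rightarrow> nat mat \<Rightarrow> nat mat \<Rightarrow> bool" where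
  "implies_reg _ M N \<longleftrightarrow>
     (\<forall>C :: ('o, 'a) cat. regular_category C \<and> closed_relations C M \<longrightarrow> closed_relations C N)"

definition Mal :: "nat mat" where
  "Mal = mat_of_rows_list 4
     [[1, 2, 2, 1],
      [2, 2, 1, 1]]"

definition Maj :: "nat mat" where
  "Maj = mat_of_rows_list 4
     [[1, 1, 2, 1],
      [1, 2, 1, 1],
      [2, 1, 1, 1]]"

end

theory Submission
  imports Defs "HOL-Library.Countable"
begin

text \<open>If some two rows of \<open>M\<close> (possibly equal) have no left column agreeing with the right column
  in both of them, then renaming variables in these rows and voiding the others turns \<open>M\<close> into
  a matrix whose left columns are among those of \<open>Mal\<close>, so \<open>M\<close> implies \<open>Mal\<close>.  Otherwise any tuple
  to which the conclusion of \<open>M\<close> applies has all its binary projections in the relation, and the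
  Baker--Pixley argument, which in a regular category works after passing to a cover, shows that
  \<open>Maj\<close> implies \<open>M\<close>.  The two implications together would, in either case, yield that \<open>Maj\<close>
  implies \<open>Mal\<close>, and this fails in the category of finite majority algebras: the order of a
  two-element chain is a subalgebra of its square, but not a Mal'tsev relation.\<close>

section \<open>Finite products and pullbacks\<close>

text \<open>The case distinction is a condition on \<open>M\<close> alone, so the same alternative
  holds over all types at once; this is what allows the two implications to be taken over unrelated
  types. The exclusion then needs a separating category in every pair of infinite types. Majority
  algebras of all sizes need not fit there, but the finite ones have countably many codes, and
  finite limits and quotients do not lead out of them.

  On the positive side the obstacle is that a regular category has no elements to choose. The
  projection of a relation to some of its coordinates is an image, so membership in it is known only
  after composition with a regular epimorphism. The induction on coordinates therefore speaks of
  membership up to a cover, and covers accumulate along the way. They are discarded once, at the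
  end: the full relation is jointly monic, so a factorisation that exists on a cover
  descends.\<close>

definition product_over ::
  "('o, 'a) cat \<Rightarrow> nat set \<Rightarrow> (nat \<Rightarrow> 'o) \<Rightarrow> 'o \<Rightarrow> (nat \<Rightarrow> 'a) \<Rightarrow> bool" where
  "product_over C I X P p \<longleftrightarrow> P \<in> Obj C \<and> (\<forall>i\<in>I. p i \<in> hom C P (X i)) \<and>
     (\<forall>T \<in> Obj C. \<forall>t. (\<forall>i\<in>I. t i \<in> hom C T (X i)) \<longrightarrow>
        (\<exists>!h. h \<in> hom C T P \<and> (\<forall>i\<in>I. Comp C (p i) h = t i)))"

text \<open>Arbitrary index sets serve two purposes: the empty product is the terminal object, and
  the Baker--Pixley step gathers a finite set of coordinates into one object.\<close>

lemma is_product_iff: "is_product C n X P p \<longleftrightarrow> product_over C {..<n} X P p"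
  by (simp only: is_product_def product_over_def Ball_def lessThan_iff)

lemma homD:
  assumes "f \<in> hom C A B"
  shows "f \<in> Arr C" "Dom C f = A" "Cod C f = B"
  using assms by (auto simp: hom_def)

context category
begin

lemma hom_obj: "f \<in> hom C A B \<Longrightarrow> A \<in> Obj C" "f \<in> hom C A B \<Longrightarrow> B \<in> Obj C"
  using dom_obj cod_obj by (auto simp: hom_def)

lemma product_over_tuple:
  assumes "product_over C I X P p" "T \<in> Obj C" "\<And>i. i \<in> I \<Longrightarrow> t i \<in> hom C T (X i)"
  obtains h where "h \<in> hom C T P" "\<And>i. i \<in> I \<Longrightarrow> Comp C (p i) h = t i"
  using assms unfolding product_over_def by metis

lemma product_over_proj:
  "product_over C I X P p \<Longrightarrow> i \<in> I \<Longrightarrow> p i \<in> hom C P (X i)"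
  by (simp add: product_over_def)

lemma product_over_eqI:
  assumes P: "product_over C I X P p" and f: "f \<in> hom C T P" and g: "g \<in> hom C T P"
    and eq: "\<And>i. i \<in> I \<Longrightarrow> Comp C (p i) f = Comp C (p i) g"
  shows "f = g"
proof -
  have "\<forall>i\<in>I. Comp C (p i) f \<in> hom C T (X i)"
    using comp_hom[OF f] product_over_proj[OF P] by blast
  then have "\<exists>!h. h \<in> hom C T P \<and> (\<forall>i\<in>I. Comp C (p i) h = Comp C (p i) f)"
    using P hom_obj(1)[OF f] unfolding product_over_def
    by (elim conjE) (erule ballE[where x = T], erule allE[where x = "\<lambda>i. Comp C (p i) f"], auto)
  with f g eq show ?thesis by metis
qed

lemma tuple_props:
  assumes P: "is_product C n X P p" and T: "T \<in> Obj C" and t: "\<And>i. i < n \<Longrightarrow> t i \<in> hom C T (X i)"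
  shows "tuple C n P p T t \<in> hom C T P" "\<And>i. i < n \<Longrightarrow> Comp C (p i) (tuple C n P p T t) = t i"
proof -
  have "\<exists>!h. h \<in> hom C T P \<and> (\<forall>i<n. Comp C (p i) h = t i)"
    using P T t unfolding is_product_def by blast
  from theI'[OF this]
  show "tuple C n P p T t \<in> hom C T P" "\<And>i. i < n \<Longrightarrow> Comp C (p i) (tuple C n P p T t) = t i"
    unfolding tuple_def by auto
qed

lemma factors_through_iff:
  assumes "f \<in> hom C T P" "r \<in> hom C R P"
  shows "factors_through C f r \<longleftrightarrow> (\<exists>h \<in> hom C T R. Comp C r h = f)"
  using assms by (auto simp: factors_through_def hom_def)

text \<open>\<open>Comp C u e\<close> coequalises the pair that defines \<open>e\<close>, and both
  \<open>u\<close> and \<open>v\<close> factor it through \<open>e\<close>; uniqueness in the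
  coequaliser identifies them.\<close>

lemma regular_epi_cancel:
  assumes "regular_epi C e" "e \<in> hom C A B" "u \<in> hom C B D" "v \<in> hom C B D"
    "Comp C u e = Comp C v e"
  shows "u = v"
proof -
  from assms(1) obtain f g where fg: "is_coequaliser C f g e" by (auto simp: regular_epi_def)
  have f: "f \<in> hom C (Dom C f) A" and g: "g \<in> hom C (Dom C f) A" and ef: "Comp C e f = Comp C e g"
    and e: "Cod C f = A" "Cod C e = B"
    using fg assms(2) by (auto simp: is_coequaliser_def hom_def)
  have "Comp C u e \<in> hom C A D" using comp_hom assms by blast
  moreover have "Comp C (Comp C u e) f = Comp C (Comp C u e) g"
    using comp_assoc[OF f assms(2,3)] comp_assoc[OF g assms(2,3)] ef by simp
  ultimately have "\<exists>!w. w \<in> hom C B D \<and> Comp C w e = Comp C u e"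
    using fg e unfolding is_coequaliser_def by blast
  then show ?thesis using assms(3-5) by metis
qed

end

text \<open>The arrows \<open>0\<close>, \<open>1\<close>, \<open>2\<close> are the identities, \<open>3: 0 \<rightarrow> 2\<close> and \<open>4: 1 \<rightarrow> 2\<close>.\<close>

definition cospan_cat :: "(nat, nat) cat" where
  "cospan_cat = \<lparr>Obj = {..<3}, Arr = {..<5}, Dom = (\<lambda>u. if u < 3 then u else u - 3),
     Cod = (\<lambda>u. if u < 3 then u else 2), Ident = id, Comp = (\<lambda>g f. if g < 3 then f else g)\<rparr>"

definition discrete_cat :: "nat set \<Rightarrow> (nat, nat) cat" where
  "discrete_cat I = \<lparr>Obj = I, Arr = I, Dom = id, Cod = id, Ident = id, Comp = (\<lambda>g f. f)\<rparr>"

lemma category_discrete_cat: "category (discrete_cat I)"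
  by unfold_locales (auto simp: discrete_cat_def hom_def)

lemma category_cospan_cat: "category cospan_cat"
  by unfold_locales (auto simp: cospan_cat_def hom_def split: if_splits)

locale lex_category = category C for C :: "('o, 'a) cat" +
  assumes finitely_complete: "finitely_complete C"
begin

lemma product_exists:
  assumes I: "finite I" and X: "\<And>i. i \<in> I \<Longrightarrow> X i \<in> Obj C"
  obtains P p where "product_over C I X P p"
proof -
  let ?J = "discrete_cat I" and ?Fa = "\<lambda>i. Ident C (X i)"
  have id: "Comp C (Ident C (X i)) (Ident C (X i)) = Ident C (X i)" if "i \<in> I" for i
    using comp_ident_left ident_hom X that by blast
  have "is_functor ?J C X ?Fa"
    using X ident_hom id by (auto simp: is_functor_def discrete_cat_def)
  then obtain L p where L: "is_limit ?J C X ?Fa L p"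
    using finitely_complete category_discrete_cat I
    unfolding finitely_complete_def by (fastforce simp: discrete_cat_def)
  \<comment> \<open>Identities impose no commutation condition, so a cone is just a family of
    arrows.\<close>
  have cone: "is_cone ?J C X ?Fa T t \<longleftrightarrow> T \<in> Obj C \<and> (\<forall>i\<in>I. t i \<in> hom C T (X i))" for T t
    using comp_ident_left by (auto simp: is_cone_def discrete_cat_def)
  have "product_over C I X L p"
    using L unfolding is_limit_def cone product_over_def by (simp add: discrete_cat_def)
  then show thesis ..
qed

lemma pullback_exists:
  assumes f: "f \<in> hom C A D" and g: "g \<in> hom C B D"
  obtains P p q where "is_pullback C f g p q" "p \<in> hom C P A" "q \<in> hom C P B"
proof -
  let ?J = cospan_cat
  define Fo where "Fo = (\<lambda>i::nat. if i = 0 then A else if i = 1 then B else D)"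
  define Fa where "Fa = (\<lambda>u::nat. if u < 3 then Ident C (Fo u) else if u = 3 then f else g)"
  note obj = hom_obj(1)[OF f] hom_obj(1)[OF g] hom_obj(2)[OF f]
  have Fo: "Fo i \<in> Obj C" for i using obj by (auto simp: Fo_def)
  have Fa: "Fa u \<in> hom C (Fo (Dom ?J u)) (Fo (Cod ?J u))" if "u < 5" for u
  proof (cases "u < 3")
    case True
    then show ?thesis using ident_hom Fo by (auto simp: Fa_def cospan_cat_def)
  next
    case False
    then have "u = 3 \<or> u = 4" using that by auto
    then show ?thesis using f g by (auto simp: Fa_def Fo_def cospan_cat_def)
  qed
  have func: "is_functor ?J C Fo Fa"
    unfolding is_functor_def
  proof (intro conjI ballI impI)
    fix u v assume uv: "u \<in> Arr ?J" "v \<in> Arr ?J" "Cod ?J u = Dom ?J v"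
    show "Fa (Comp ?J v u) = Comp C (Fa v) (Fa u)"
    proof (cases "v < 3")
      case True
      then show ?thesis
        using uv comp_ident_left[OF Fa[of u]] by (auto simp: cospan_cat_def Fa_def)
    next
      case False
      then have "u < 3" using uv by (auto simp: cospan_cat_def split: if_splits)
      then show ?thesis
        using uv False comp_ident_right[OF Fa[of v]] by (auto simp: cospan_cat_def Fa_def)
    qed
  qed (use Fo Fa in \<open>auto simp: cospan_cat_def Fa_def\<close>)
  moreover have "finite (Obj ?J)" "finite (Arr ?J)" by (auto simp: cospan_cat_def)
  ultimately obtain L p where L: "is_limit ?J C Fo Fa L p"
    using finitely_complete category_cospan_cat unfolding finitely_complete_def by blast
  have ob: "(\<forall>j \<in> Obj ?J. Q j) \<longleftrightarrow> Q 0 \<and> Q 1 \<and> Q 2" for Q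
    by (auto simp: cospan_cat_def eval_nat_numeral less_Suc_eq)
  have ar: "(\<forall>j \<in> Arr ?J. Q j) \<longleftrightarrow> Q 0 \<and> Q 1 \<and> Q 2 \<and> Q 3 \<and> Q 4" for Q
    by (auto simp: cospan_cat_def eval_nat_numeral less_Suc_eq)
  have cone: "is_cone ?J C Fo Fa T t \<longleftrightarrow> t 0 \<in> hom C T A \<and> t 1 \<in> hom C T B \<and>
      Comp C f (t 0) = t 2 \<and> Comp C g (t 1) = t 2" for T t
    unfolding is_cone_def ob ar
    using comp_ident_left[of "t 0" T A] comp_ident_left[of "t 1" T B] comp_ident_left[of "t 2" T D]
      comp_hom[OF _ f, of "t 0" T] hom_obj(1)[of "t 0" T A]
    by (auto simp: cospan_cat_def Fa_def Fo_def)
  have p: "p 0 \<in> hom C L A" "p 1 \<in> hom C L B" "Comp C f (p 0) = p 2" "Comp C g (p 1) = p 2"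
    using L unfolding is_limit_def cone by auto
  have "is_pullback C f g (p 0) (p 1)"
    unfolding is_pullback_def
  proof (intro conjI allI ballI impI)
    fix T a b assume a: "a \<in> hom C T (Dom C f)" and b: "b \<in> hom C T (Dom C g)"
      and ab: "Comp C f a = Comp C g b"
    define t where "t = (\<lambda>i::nat. if i = 0 then a else if i = 1 then b else Comp C f a)"
    have "is_cone ?J C Fo Fa T t"
      unfolding cone using a b ab homD(2)[OF f] homD(2)[OF g] by (auto simp: t_def)
    then have ex1: "\<exists>!h. h \<in> hom C T L \<and> Comp C (p 0) h = a \<and> Comp C (p 1) h = b \<and>
        Comp C (p 2) h = Comp C f a"
      using L[unfolded is_limit_def ob, THEN conjunct2, rule_format, of T t] by (simp add: t_def)
    \<comment> \<open>The leg to the vertex of the cospan follows from the other two, so uniqueness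
      for the three-legged cone gives uniqueness for the square.\<close>
    have "Comp C (p 2) h = Comp C f a" if "h \<in> hom C T L" "Comp C (p 0) h = a" for h
      using comp_assoc[OF that(1) p(1) f] that(2) p(3) by simp
    with ex1 show "\<exists>!h. h \<in> hom C T (Dom C (p 0)) \<and> Comp C (p 0) h = a \<and> Comp C (p 1) h = b"
      unfolding homD(2)[OF p(1)] by (metis (no_types))
  qed (use p homD[OF f] homD[OF g] in \<open>auto simp: hom_def\<close>)
  with p that show thesis by blast
qed

end

section \<open>Matrix properties in terms of jointly monic families\<close>

text \<open>These are the components of a monomorphism into a product. Kept as a family, a row can
  be replaced or made void without forming a product.\<close>

definition jointly_monic :: "('o, 'a) cat \<Rightarrow> nat set \<Rightarrow> (nat \<Rightarrow> 'o) \<Rightarrow> 'o \<Rightarrow> (nat \<Rightarrow> 'a) \<Rightarrow> bool" where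
  "jointly_monic C I X R r \<longleftrightarrow> R \<in> Obj C \<and> (\<forall>i\<in>I. r i \<in> hom C R (X i)) \<and>
     (\<forall>T. \<forall>f \<in> hom C T R. \<forall>g \<in> hom C T R.
        (\<forall>i\<in>I. Comp C (r i) f = Comp C (r i) g) \<longrightarrow> f = g)"

text \<open>Factorisation is stated coordinatewise, which keeps \<open>tuple\<close> with its
  definite description, and the interpreted matrix \<open>B\<close>, out of all later
  arguments.\<close>

definition closed_families :: "('o, 'a) cat \<Rightarrow> nat mat \<Rightarrow> bool" where
  "closed_families C M \<longleftrightarrow>
     (\<forall>n m k X S R r f.
        M \<in> matr_nmk n m k \<and> S \<in> Obj C \<and> jointly_monic C {..<n} X R r \<and>
        (\<forall>i<n. X i \<in> Obj C) \<and>
        (\<forall>i<n. \<forall>v\<in>{1..k}. f i v \<in> hom C S (X i)) \<and>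
        (\<forall>l<m. \<exists>h \<in> hom C S R. \<forall>i<n. Comp C (r i) h = f i (M $$ (i, l))) \<longrightarrow>
        (\<exists>h \<in> hom C S R. \<forall>i<n. Comp C (r i) h = f i (M $$ (i, m))))"

lemma matr_nmk_entry: "M \<in> matr_nmk n m k \<Longrightarrow> i < n \<Longrightarrow> l \<le> m \<Longrightarrow> M $$ (i, l) \<in> {1..k}"
  by (simp add: matr_nmk_def)

context category
begin

lemma jointly_monic_hom: "jointly_monic C I X R r \<Longrightarrow> i \<in> I \<Longrightarrow> r i \<in> hom C R (X i)"
  by (simp add: jointly_monic_def)

lemma jointly_monicD:
  "jointly_monic C I X R r \<Longrightarrow> f \<in> hom C T R \<Longrightarrow> g \<in> hom C T R \<Longrightarrow>
    (\<And>i. i \<in> I \<Longrightarrow> Comp C (r i) f = Comp C (r i) g) \<Longrightarrow> f = g"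
  unfolding jointly_monic_def by blast

lemma monic_jointly_monic:
  assumes P: "product_over C I X P p" and r: "r \<in> hom C R P"
  shows "monic C r \<longleftrightarrow> jointly_monic C I X R (\<lambda>i. Comp C (p i) r)"
proof -
  have assoc: "Comp C (Comp C (p i) r) f = Comp C (p i) (Comp C r f)" if "i \<in> I" "f \<in> hom C T R" for i f T
    using comp_assoc[OF that(2) r product_over_proj[OF P that(1)]] .
  have "(\<forall>i\<in>I. Comp C (Comp C (p i) r) f = Comp C (Comp C (p i) r) g) \<longleftrightarrow> Comp C r f = Comp C r g"
    if "f \<in> hom C T R" "g \<in> hom C T R" for f g T
    using assoc that product_over_eqI[OF P comp_hom[OF that(1) r] comp_hom[OF that(2) r]]
    by (metis (no_types))
  moreover have "\<forall>i\<in>I. Comp C (p i) r \<in> hom C R (X i)"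
    using comp_hom[OF r] product_over_proj[OF P] by blast
  ultimately show ?thesis
    using homD[OF r] hom_obj(1)[OF r] by (simp add: monic_def jointly_monic_def)
qed

lemma factors_through_tuple:
  assumes P: "is_product C n X P p" and S: "S \<in> Obj C" and t: "\<And>i. i < n \<Longrightarrow> t i \<in> hom C S (X i)"
    and r: "r \<in> hom C R P"
  shows "factors_through C (tuple C n P p S t) r \<longleftrightarrow>
    (\<exists>h \<in> hom C S R. \<forall>i<n. Comp C (Comp C (p i) r) h = t i)"
proof -
  note tup = tuple_props[OF P S t]
  have "Comp C r h = tuple C n P p S t \<longleftrightarrow> (\<forall>i<n. Comp C (Comp C (p i) r) h = t i)"
    if h: "h \<in> hom C S R" for h
  proof -
    have "Comp C (Comp C (p i) r) h = Comp C (p i) (Comp C r h)" if "i < n" for i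
      using comp_assoc[OF h r] P that unfolding is_product_def by blast
    moreover have "Comp C r h = tuple C n P p S t \<longleftrightarrow>
        (\<forall>i<n. Comp C (p i) (Comp C r h) = Comp C (p i) (tuple C n P p S t))"
      using product_over_eqI[OF P[unfolded is_product_iff] comp_hom[OF h r] tup(1)] by auto
    ultimately show ?thesis using tup(2) by simp
  qed
  then show ?thesis using factors_through_iff[OF tup(1) r] by auto
qed

lemma closed_relations_if_families:
  assumes M: "closed_families C M"
  shows "closed_relations C M"
  unfolding closed_relations_def
proof (intro allI impI, elim conjE)
  fix n m k X S P p r B
  assume Mn: "M \<in> matr_nmk n m k" and X: "\<forall>i<n. X i \<in> Obj C" and S: "S \<in> Obj C"
    and P: "is_product C n X P p" and r: "monic C r" "Cod C r = P"
    and B: "rowwise_interpretation n m k M (\<lambda>i. hom C S (X i)) B"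
    and left: "\<forall>l<m. factors_through C (tuple C n P p S (\<lambda>i. B $$ (i, l))) r"
  obtain f where f: "\<forall>i<n. \<forall>v\<in>{1..k}. f i v \<in> hom C S (X i)"
    and Bf: "B = mat n (m + 1) (\<lambda>(i, j). f i (M $$ (i, j)))"
    using B unfolding rowwise_interpretation_def by blast
  have Bi: "B $$ (i, l) = f i (M $$ (i, l))" "B $$ (i, l) \<in> hom C S (X i)" if "i < n" "l \<le> m" for i l
    using that f matr_nmk_entry[OF Mn that] by (auto simp: Bf)
  have r': "r \<in> hom C (Dom C r) P" using r by (auto simp: monic_def hom_def)
  have jm: "jointly_monic C {..<n} X (Dom C r) (\<lambda>i. Comp C (p i) r)"
    using monic_jointly_monic[OF P[unfolded is_product_iff] r'] r(1) by blast
  have eq: "factors_through C (tuple C n P p S (\<lambda>i. B $$ (i, l))) r \<longleftrightarrow>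
     (\<exists>h \<in> hom C S (Dom C r). \<forall>i<n. Comp C (Comp C (p i) r) h = f i (M $$ (i, l)))"
    if "l \<le> m" for l
    using factors_through_tuple[OF P S _ r', of "\<lambda>i. B $$ (i, l)"] Bi that by simp
  have "\<forall>l<m. \<exists>h \<in> hom C S (Dom C r). \<forall>i<n. Comp C (Comp C (p i) r) h = f i (M $$ (i, l))"
    using left eq by simp
  then have "\<exists>h \<in> hom C S (Dom C r). \<forall>i<n. Comp C (Comp C (p i) r) h = f i (M $$ (i, m))"
    using M Mn S jm X f unfolding closed_families_def by blast
  then show "factors_through C (tuple C n P p S (\<lambda>i. B $$ (i, m))) r"
    using eq by simp
qed

end

context lex_category
begin

text \<open>Passing from relations to families is the direction that uses finite completeness: the
  product of the \<open>X i\<close> must be formed before a jointly monic family becomes a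
  monomorphism.\<close>

lemma closed_relations_iff_families: "closed_relations C M \<longleftrightarrow> closed_families C M"
proof
  assume M: "closed_relations C M"
  show "closed_families C M"
    unfolding closed_families_def
  proof (intro allI impI, elim conjE)
    fix n m k X S R r f
    assume Mn: "M \<in> matr_nmk n m k" and S: "S \<in> Obj C" and jm: "jointly_monic C {..<n} X R r"
      and X: "\<forall>i<n. X i \<in> Obj C" and f: "\<forall>i<n. \<forall>v\<in>{1..k}. f i v \<in> hom C S (X i)"
      and left: "\<forall>l<m. \<exists>h \<in> hom C S R. \<forall>i<n. Comp C (r i) h = f i (M $$ (i, l))"
    obtain P p where Po: "product_over C {..<n} X P p"
      using product_exists[of "{..<n}" X] X by blast
    then have P: "is_product C n X P p" by (simp add: is_product_iff)
    obtain \<rho> where \<rho>: "\<rho> \<in> hom C R P" "\<And>i. i < n \<Longrightarrow> Comp C (p i) \<rho> = r i"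
      using product_over_tuple[OF Po, of R r] jm unfolding jointly_monic_def by (metis lessThan_iff)
    have "jointly_monic C {..<n} X R (\<lambda>i. Comp C (p i) \<rho>)"
      using jm \<rho>(2) by (simp add: jointly_monic_def)
    then have mon: "monic C \<rho>" using monic_jointly_monic[OF Po \<rho>(1)] by blast
    define B where "B = mat n (m + 1) (\<lambda>(i, j). f i (M $$ (i, j)))"
    have Bi: "B $$ (i, l) = f i (M $$ (i, l))" "B $$ (i, l) \<in> hom C S (X i)" if "i < n" "l \<le> m" for i l
      using that f matr_nmk_entry[OF Mn that] by (auto simp: B_def)
    have B: "rowwise_interpretation n m k M (\<lambda>i. hom C S (X i)) B"
      unfolding rowwise_interpretation_def using f B_def by blast
    have eq: "factors_through C (tuple C n P p S (\<lambda>i. B $$ (i, l))) \<rho> \<longleftrightarrow>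
       (\<exists>h \<in> hom C S R. \<forall>i<n. Comp C (r i) h = f i (M $$ (i, l)))"
      if "l \<le> m" for l
      using factors_through_tuple[OF P S _ \<rho>(1), of "\<lambda>i. B $$ (i, l)"] Bi that \<rho>(2) by simp
    have "\<forall>l<m. factors_through C (tuple C n P p S (\<lambda>i. B $$ (i, l))) \<rho>"
      using eq left by simp
    then have "factors_through C (tuple C n P p S (\<lambda>i. B $$ (i, m))) \<rho>"
      using M Mn X S P mon homD(3)[OF \<rho>(1)] B unfolding closed_relations_def by blast
    then show "\<exists>h \<in> hom C S R. \<forall>i<n. Comp C (r i) h = f i (M $$ (i, m))"
      using eq by simp
  qed
qed (rule closed_relations_if_families)

end

section \<open>Matrices without a column agreeing with the right column in two given rows\<close>

text \<open>\<open>dim_col M - 1\<close> is both the number of left columns and the index of the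
  right one. The case \<open>i = j\<close> matters: a matrix in which the right entry of some row is
  absent from the left, such as one without left columns, has to fall on the side of
  \<open>Mal\<close>.\<close>

definition pairwise_agreeing :: "nat mat \<Rightarrow> bool" where
  "pairwise_agreeing M \<longleftrightarrow> (\<forall>i<dim_row M. \<forall>j<dim_row M. \<exists>l<dim_col M - 1.
     M $$ (i, l) = M $$ (i, dim_col M - 1) \<and> M $$ (j, l) = M $$ (j, dim_col M - 1))"

section \<open>Explicit forms of the properties given by \<open>Mal\<close> and
  \<open>Maj\<close>\<close>

lemma Mal_dim: "dim_row Mal = 2" "dim_col Mal = 4"
  by (simp_all add: Mal_def mat_of_rows_list_def)

lemma Maj_dim: "dim_row Maj = 3" "dim_col Maj = 4"
  by (simp_all add: Maj_def mat_of_rows_list_def)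

lemma Mal_entries:
  "Mal $$ (0, 0) = 1" "Mal $$ (0, Suc 0) = 2" "Mal $$ (0, 2) = 2" "Mal $$ (0, 3) = 1"
  "Mal $$ (Suc 0, 0) = 2" "Mal $$ (Suc 0, Suc 0) = 2" "Mal $$ (Suc 0, 2) = 1" "Mal $$ (Suc 0, 3) = 1"
  by (simp_all add: Mal_def mat_of_rows_list_def)

lemma Maj_entries:
  "Maj $$ (0, 0) = 1" "Maj $$ (0, Suc 0) = 1" "Maj $$ (0, 2) = 2" "Maj $$ (0, 3) = 1"
  "Maj $$ (Suc 0, 0) = 1" "Maj $$ (Suc 0, Suc 0) = 2" "Maj $$ (Suc 0, 2) = 1" "Maj $$ (Suc 0, 3) = 1"
  "Maj $$ (2, 0) = 2" "Maj $$ (2, Suc 0) = 1" "Maj $$ (2, 2) = 1" "Maj $$ (2, 3) = 1"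
  by (simp_all add: Maj_def mat_of_rows_list_def)

lemma less_2_iff: "i < (2::nat) \<longleftrightarrow> i = 0 \<or> i = 1"
  by auto

lemma less_3_iff: "i < (3::nat) \<longleftrightarrow> i = 0 \<or> i = 1 \<or> i = 2"
  by auto

lemma le_3_iff: "i \<le> (3::nat) \<longleftrightarrow> i = 0 \<or> i = 1 \<or> i = 2 \<or> i = 3"
  by auto

lemma Mal_in_matr_nmk_iff: "Mal \<in> matr_nmk n m k \<longleftrightarrow> n = 2 \<and> m = 3 \<and> 2 \<le> k"
  using Mal_dim by (auto simp: matr_nmk_def less_2_iff le_3_iff Mal_entries)

lemma Maj_in_matr_nmk_iff: "Maj \<in> matr_nmk n m k \<longleftrightarrow> n = 3 \<and> m = 3 \<and> 2 \<le> k"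
  using Maj_dim by (auto simp: matr_nmk_def less_3_iff le_3_iff Maj_entries)

text \<open>This is difunctionality. \<open>u\<close>, \<open>v\<close> are the values of
  \<open>x\<^sub>1\<close>, \<open>x\<^sub>2\<close> in the upper row and \<open>s\<close>,
  \<open>t\<close> those in the lower row, so the left columns read \<open>(u, t)\<close>,
  \<open>(v, t)\<close>, \<open>(v, s)\<close> and the right one \<open>(u, s)\<close>.\<close>

lemma closed_families_Mal_iff:
  "closed_families C Mal \<longleftrightarrow>
    (\<forall>X S R r u v s t. S \<in> Obj C \<and> jointly_monic C {..<2} X R r \<and>
       (\<forall>i<2. X i \<in> Obj C) \<and>
       {u, v} \<subseteq> hom C S (X 0) \<and> {s, t} \<subseteq> hom C S (X 1) \<and>
       (\<exists>h \<in> hom C S R. Comp C (r 0) h = u \<and> Comp C (r 1) h = t) \<and>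
       (\<exists>h \<in> hom C S R. Comp C (r 0) h = v \<and> Comp C (r 1) h = t) \<and>
       (\<exists>h \<in> hom C S R. Comp C (r 0) h = v \<and> Comp C (r 1) h = s) \<longrightarrow>
       (\<exists>h \<in> hom C S R. Comp C (r 0) h = u \<and> Comp C (r 1) h = s))" (is "?L \<longleftrightarrow> ?R")
proof
  assume L: ?L
  show ?R
  proof (intro allI impI, elim conjE)
    fix X S R r u v s t
    assume A: "S \<in> Obj C" "jointly_monic C {..<2} X R r" "\<forall>i<2. X i \<in> Obj C"
      "{u, v} \<subseteq> hom C S (X 0)" "{s, t} \<subseteq> hom C S (X 1)"
      "\<exists>h \<in> hom C S R. Comp C (r 0) h = u \<and> Comp C (r 1) h = t"
      "\<exists>h \<in> hom C S R. Comp C (r 0) h = v \<and> Comp C (r 1) h = t"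
      "\<exists>h \<in> hom C S R. Comp C (r 0) h = v \<and> Comp C (r 1) h = s"
    define f where "f = (\<lambda>i x::nat. if i = (0::nat) then (if x = 1 then u else v)
      else (if x = 1 then s else t))"
    have "Mal \<in> matr_nmk 2 3 2" by (simp add: Mal_in_matr_nmk_iff)
    moreover have "\<forall>i<2. \<forall>x\<in>{1..2}. f i x \<in> hom C S (X i)"
      using A by (auto simp: f_def less_2_iff)
    moreover have "\<forall>l<3. \<exists>h \<in> hom C S R. \<forall>i<2. Comp C (r i) h = f i (Mal $$ (i, l))"
      using A(6-8) by (auto simp: f_def less_2_iff less_3_iff Mal_entries)
    ultimately have "\<exists>h \<in> hom C S R. \<forall>i<2. Comp C (r i) h = f i (Mal $$ (i, 3))"
      using L A(1-3) unfolding closed_families_def by blast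
    then show "\<exists>h \<in> hom C S R. Comp C (r 0) h = u \<and> Comp C (r 1) h = s"
      by (auto simp: f_def less_2_iff Mal_entries)
  qed
next
  assume R: ?R
  show ?L
    unfolding closed_families_def
  proof (intro allI impI, elim conjE)
    fix n m k X S R r f
    assume A: "Mal \<in> matr_nmk n m k" "S \<in> Obj C" "jointly_monic C {..<n} X R r"
      "\<forall>i<n. X i \<in> Obj C" "\<forall>i<n. \<forall>v\<in>{1..k}. f i v \<in> hom C S (X i)"
      "\<forall>l<m. \<exists>h \<in> hom C S R. \<forall>i<n. Comp C (r i) h = f i (Mal $$ (i, l))"
    from A(1) have [simp]: "n = 2" "m = 3" and k: "2 \<le> k" by (auto simp: Mal_in_matr_nmk_iff)
    have "\<exists>h \<in> hom C S R. Comp C (r 0) h = f 0 1 \<and> Comp C (r 1) h = f 1 1"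
      by (rule R[rule_format, of S X R r "f 0 1" "f 0 2" "f 1 1" "f 1 2"])
        (use A(2-6) k in \<open>auto simp: less_2_iff less_3_iff Mal_entries all_conj_distrib\<close>)
    then show "\<exists>h \<in> hom C S R. \<forall>i<n. Comp C (r i) h = f i (Mal $$ (i, m))"
      by (auto simp: less_2_iff Mal_entries)
  qed
qed

text \<open>\<open>f\<close> and \<open>g\<close> hold the values of \<open>x\<^sub>1\<close> and
  \<open>x\<^sub>2\<close> in each row. The single \<open>x\<^sub>2\<close> of column
  \<open>j\<close> of \<open>Maj\<close> stands in row \<open>2 - j\<close>, whence the reversed
  index.\<close>

lemma closed_families_Maj_iff:
  "closed_families C Maj \<longleftrightarrow>
    (\<forall>X S R r f g. S \<in> Obj C \<and> jointly_monic C {..<3} X R r \<and>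
       (\<forall>i<3. X i \<in> Obj C) \<and>
       (\<forall>i<3. f i \<in> hom C S (X i) \<and> g i \<in> hom C S (X i)) \<and>
       (\<forall>j<3. \<exists>h \<in> hom C S R. \<forall>i<3. Comp C (r i) h = (if i = 2 - j then g i else f i)) \<longrightarrow>
       (\<exists>h \<in> hom C S R. \<forall>i<3. Comp C (r i) h = f i))" (is "?L \<longleftrightarrow> ?R")
proof
  assume L: ?L
  show ?R
  proof (intro allI impI, elim conjE)
    fix X S R r f g
    assume A: "S \<in> Obj C" "jointly_monic C {..<3} X R r" "\<forall>i<3. X i \<in> Obj C"
      "\<forall>i<3. f i \<in> hom C S (X i) \<and> g i \<in> hom C S (X i)"
      "\<forall>j<3. \<exists>h \<in> hom C S R. \<forall>i<3. Comp C (r i) h = (if i = 2 - j then g i else f i)"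
    define w where "w = (\<lambda>i x::nat. if x = 1 then f i else g i)"
    have "Maj \<in> matr_nmk 3 3 2" by (simp add: Maj_in_matr_nmk_iff)
    moreover have "\<forall>i<3. \<forall>x\<in>{1..2}. w i x \<in> hom C S (X i)"
      using A by (auto simp: w_def)
    moreover have "\<forall>l<3. \<exists>h \<in> hom C S R. \<forall>i<3. Comp C (r i) h = w i (Maj $$ (i, l))"
      using A(5) by (auto simp: w_def less_3_iff Maj_entries)
    ultimately have "\<exists>h \<in> hom C S R. \<forall>i<3. Comp C (r i) h = w i (Maj $$ (i, 3))"
      using L A(1-3) unfolding closed_families_def by blast
    then show "\<exists>h \<in> hom C S R. \<forall>i<3. Comp C (r i) h = f i"
      by (auto simp: w_def less_3_iff Maj_entries)
  qed
next
  assume R: ?R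
  show ?L
    unfolding closed_families_def
  proof (intro allI impI, elim conjE)
    fix n m k X S R r f
    assume A: "Maj \<in> matr_nmk n m k" "S \<in> Obj C" "jointly_monic C {..<n} X R r"
      "\<forall>i<n. X i \<in> Obj C" "\<forall>i<n. \<forall>v\<in>{1..k}. f i v \<in> hom C S (X i)"
      "\<forall>l<m. \<exists>h \<in> hom C S R. \<forall>i<n. Comp C (r i) h = f i (Maj $$ (i, l))"
    from A(1) have [simp]: "n = 3" "m = 3" and k: "2 \<le> k" by (auto simp: Maj_in_matr_nmk_iff)
    have "\<exists>h \<in> hom C S R. \<forall>i<3. Comp C (r i) h = f i 1"
      by (rule R[rule_format, of S X R r "\<lambda>i. f i 1" "\<lambda>i. f i 2"])
        (use A(2-6) k in \<open>auto simp: less_3_iff Maj_entries all_conj_distrib\<close>)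
    then show "\<exists>h \<in> hom C S R. \<forall>i<n. Comp C (r i) h = f i (Maj $$ (i, m))"
      by (auto simp: less_3_iff Maj_entries)
  qed
qed

context lex_category
begin

lemma terminal_exists:
  obtains Z where "Z \<in> Obj C" "\<And>T. T \<in> Obj C \<Longrightarrow> \<exists>!h. h \<in> hom C T Z"
proof -
  obtain P p where "product_over C {} undefined P p"
    using product_exists[of "{}" undefined] by auto
  then show thesis using that[of P] unfolding product_over_def by simp
qed

text \<open>If in every row the right entry is renamed to \<open>x\<^sub>1\<close> and the other variables to \<open>x\<^sub>2\<close>,
  the left columns restricted to the rows \<open>i\<close> and \<open>j\<close> are among those of \<open>Mal\<close>, up to their
  order.  Putting the terminal object into the other rows makes them void.\<close>

lemma closed_families_Mal_if_no_agreement: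
  assumes M: "closed_families C M" and Mn: "M \<in> matr_nmk n m k" and ij: "i < n" "j < n"
    and no: "\<And>l. l < m \<Longrightarrow> M $$ (i, l) \<noteq> M $$ (i, m) \<or> M $$ (j, l) \<noteq> M $$ (j, m)"
  shows "closed_families C Mal"
  unfolding closed_families_Mal_iff
proof (intro allI impI, elim conjE)
  fix X S R r u v s t
  assume S: "S \<in> Obj C" and jm: "jointly_monic C {..<2} X R r" and X: "\<forall>i<2. X i \<in> Obj C"
    and uv: "{u, v} \<subseteq> hom C S (X 0)" and st: "{s, t} \<subseteq> hom C S (X 1)"
    and "\<exists>h \<in> hom C S R. Comp C (r 0) h = u \<and> Comp C (r 1) h = t"
      "\<exists>h \<in> hom C S R. Comp C (r 0) h = v \<and> Comp C (r 1) h = t"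
      "\<exists>h \<in> hom C S R. Comp C (r 0) h = v \<and> Comp C (r 1) h = s"
  then obtain h0 h1 h2 where h: "h0 \<in> hom C S R" "h1 \<in> hom C S R" "h2 \<in> hom C S R"
    and rh: "Comp C (r 0) h0 = u" "Comp C (r 1) h0 = t" "Comp C (r 0) h1 = v" "Comp C (r 1) h1 = t"
      "Comp C (r 0) h2 = v" "Comp C (r 1) h2 = s"
    by blast
  have r: "r 0 \<in> hom C R (X 0)" "r 1 \<in> hom C R (X 1)" and R: "R \<in> Obj C"
    using jm by (auto simp: jointly_monic_def)
  obtain Z where Z: "Z \<in> Obj C" and bang: "\<And>T. T \<in> Obj C \<Longrightarrow> \<exists>!h. h \<in> hom C T Z"
    using terminal_exists by blast
  from bang[OF S] bang[OF R] obtain bS bR where b: "bS \<in> hom C S Z" "bR \<in> hom C R Z" by blast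
  have bang_eq: "Comp C bR h = bS" if "h \<in> hom C S R" for h
    using bang[OF S] comp_hom[OF that b(2)] b(1) by blast
  show "\<exists>h \<in> hom C S R. Comp C (r 0) h = u \<and> Comp C (r 1) h = s"
  proof (cases "i = j")
    case False
    define X' where "X' = (\<lambda>q. if q = i then X 0 else if q = j then X 1 else Z)"
    define r' where "r' = (\<lambda>q. if q = i then r 0 else if q = j then r 1 else bR)"
    define f where "f = (\<lambda>q x. if q = i then (if x = M $$ (i, m) then u else v)
      else if q = j then (if x = M $$ (j, m) then s else t) else bS)"
    have jm': "jointly_monic C {..<n} X' R r'"
      unfolding jointly_monic_def
    proof (intro conjI allI ballI impI)
      fix T a c assume a: "a \<in> hom C T R" and c: "c \<in> hom C T R"
        and eq: "\<forall>q\<in>{..<n}. Comp C (r' q) a = Comp C (r' q) c"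
      have "Comp C (r q) a = Comp C (r q) c" if "q < 2" for q
        using eq[rule_format, of i] eq[rule_format, of j] ij that False
        by (auto simp: r'_def less_2_iff)
      then show "a = c" using jointly_monicD[OF jm a c] by simp
    qed (use R r b in \<open>auto simp: r'_def X'_def\<close>)
    \<comment> \<open>In rows \<open>i\<close> and \<open>j\<close> the interpreted column is
      \<open>(u, t)\<close>, \<open>(v, s)\<close> or \<open>(v, t)\<close>, witnessed by
      \<open>h0\<close>, \<open>h2\<close>, \<open>h1\<close>. The fourth pair \<open>(u, s)\<close>
      would be agreement in both rows, which \<open>no\<close> excludes.\<close>
    have "\<exists>h \<in> hom C S R. \<forall>q<n. Comp C (r' q) h = f q (M $$ (q, l))" if "l < m" for l
      by (rule bexI[of _ "if M $$ (i, l) = M $$ (i, m) then h0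
            else if M $$ (j, l) = M $$ (j, m) then h2 else h1"])
        (use no[OF that] h rh bang_eq in \<open>auto simp: r'_def f_def\<close>)
    moreover have "\<forall>q<n. \<forall>x\<in>{1..k}. f q x \<in> hom C S (X' q)"
      using uv st b by (auto simp: f_def X'_def)
    moreover have "\<forall>q<n. X' q \<in> Obj C" using X Z by (auto simp: X'_def)
    ultimately have "\<exists>h \<in> hom C S R. \<forall>q<n. Comp C (r' q) h = f q (M $$ (q, m))"
      using M Mn S jm' unfolding closed_families_def by blast
    then obtain h where "h \<in> hom C S R" "\<And>q. q < n \<Longrightarrow> Comp C (r' q) h = f q (M $$ (q, m))"
      by blast
    from this(1) this(2)[OF ij(1)] this(2)[OF ij(2)] False show ?thesis
      by (auto simp: r'_def f_def)
  next
    case True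
    \<comment> \<open>Here the right entry of row \<open>i\<close> never occurs on the left. Both
      coordinates are packed into this one row by means of \<open>P\<close>: every left column
      becomes the known member \<open>h1\<close>, while the right entry is free and is sent to the
      pair \<open>y\<close> of \<open>u\<close> and \<open>s\<close>.\<close>
    obtain P p where P: "product_over C {..<2} X P p" using product_exists[of "{..<2}" X] X by auto
    obtain \<rho> where \<rho>: "\<rho> \<in> hom C R P" "\<And>q. q \<in> {..<2} \<Longrightarrow> Comp C (p q) \<rho> = r q"
      using product_over_tuple[OF P R, of r] jointly_monic_hom[OF jm] by blast
    have us: "(if q = 0 then u else s) \<in> hom C S (X q)" if "q \<in> {..<2}" for q
      using uv st that by (auto simp: less_2_iff)
    obtain y where y: "y \<in> hom C S P" "\<And>q. q \<in> {..<2} \<Longrightarrow> Comp C (p q) y = (if q = 0 then u else s)"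
      using product_over_tuple[OF P S us] by blast
    have p\<rho>: "Comp C (r q) h = Comp C (p q) (Comp C \<rho> h)" if "h \<in> hom C T R" "q \<in> {..<2}" for h q T
      using comp_assoc[OF that(1) \<rho>(1) product_over_proj[OF P that(2)]] \<rho>(2)[OF that(2)] by simp
    define X' where "X' = (\<lambda>q. if q = i then P else Z)"
    define r' where "r' = (\<lambda>q. if q = i then \<rho> else bR)"
    define f where "f = (\<lambda>q x. if q = i then (if x = M $$ (i, m) then y else Comp C \<rho> h1) else bS)"
    have jm': "jointly_monic C {..<n} X' R r'"
      unfolding jointly_monic_def
    proof (intro conjI allI ballI impI)
      fix T a c assume a: "a \<in> hom C T R" and c: "c \<in> hom C T R"
        and eq: "\<forall>q\<in>{..<n}. Comp C (r' q) a = Comp C (r' q) c"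
      have "Comp C \<rho> a = Comp C \<rho> c"
        using eq ij by (auto simp: r'_def split: if_splits)
      then show "a = c" using jointly_monicD[OF jm a c] p\<rho>[OF a] p\<rho>[OF c] by simp
    qed (use R \<rho>(1) b in \<open>auto simp: r'_def X'_def\<close>)
    have "\<exists>h \<in> hom C S R. \<forall>q<n. Comp C (r' q) h = f q (M $$ (q, l))" if "l < m" for l
      by (rule bexI[of _ h1]) (use no[OF that] True h bang_eq in \<open>auto simp: r'_def f_def\<close>)
    moreover have "\<forall>q<n. \<forall>x\<in>{1..k}. f q x \<in> hom C S (X' q)"
      using y(1) comp_hom[OF h(2) \<rho>(1)] b by (auto simp: f_def X'_def)
    moreover have "\<forall>q<n. X' q \<in> Obj C" using P Z by (auto simp: X'_def product_over_def)
    ultimately have "\<exists>h \<in> hom C S R. \<forall>q<n. Comp C (r' q) h = f q (M $$ (q, m))"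
      using M Mn S jm' unfolding closed_families_def by blast
    then obtain h where h': "h \<in> hom C S R" "Comp C \<rho> h = y"
      using ij by (auto simp: r'_def f_def split: if_splits)
    then show ?thesis using p\<rho>[OF h'(1)] y(2) by (auto intro!: bexI[of _ h])
  qed
qed

end

lemma implies_reg_Mal:
  assumes "M \<in> matr" "\<not> pairwise_agreeing M"
  shows "implies_reg T M Mal"
proof -
  obtain n m k where M: "M \<in> matr_nmk n m k" using assms(1) by (auto simp: matr_def)
  then have "dim_row M = n" "dim_col M - 1 = m" by (auto simp: matr_nmk_def)
  with assms(2) obtain i j where ij: "i < n" "j < n"
    "\<And>l. l < m \<Longrightarrow> M $$ (i, l) \<noteq> M $$ (i, m) \<or> M $$ (j, l) \<noteq> M $$ (j, m)"
    unfolding pairwise_agreeing_def by blast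
  show ?thesis
    unfolding implies_reg_def
  proof (intro allI impI, elim conjE)
    fix C :: "('c, 'd) cat" assume C: "regular_category C" "closed_relations C M"
    then have "finitely_complete C" by (simp add: regular_category_def)
    then interpret lex_category C
      by (simp add: lex_category_def lex_category_axioms_def finitely_complete_def)
    show "closed_relations C Mal"
      using closed_families_Mal_if_no_agreement[OF _ M ij] C(2) closed_relations_iff_families by blast
  qed
qed

section \<open>Covers and images in regular categories\<close>

text \<open>Composites of regular epimorphisms, so that closure under composition holds by
  construction.\<close>

inductive cover :: "('o, 'a) cat \<Rightarrow> 'o \<Rightarrow> 'o \<Rightarrow> 'a \<Rightarrow> bool" for C S where
  cover_ident: "S \<in> Obj C \<Longrightarrow> cover C S S (Ident C S)"
| cover_regular_epi: "cover C S T c \<Longrightarrow> e \<in> hom C T' T \<Longrightarrow> regular_epi C e \<Longrightarrow>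
    cover C S T' (Comp C c e)"

locale regular_cat = lex_category C for C :: "('o, 'a) cat" +
  assumes kernel_pair_coequaliser: "is_kernel_pair C f p q \<Longrightarrow> \<exists>e. is_coequaliser C p q e"
    and regular_epi_pullback: "is_pullback C f g p q \<Longrightarrow> regular_epi C f \<Longrightarrow> regular_epi C q"
begin

lemma cover_hom: "cover C S T c \<Longrightarrow> c \<in> hom C T S"
  by (induction rule: cover.induct) (use ident_hom comp_hom in blast)+

lemma cover_cancel:
  assumes "cover C S T c" "u \<in> hom C S D" "v \<in> hom C S D" "Comp C u c = Comp C v c"
  shows "u = v"
  using assms
proof (induction arbitrary: u v rule: cover.induct)
  case cover_ident
  then show ?case using comp_ident_right by metis
next
  case (cover_regular_epi T c e T')
  note c = cover_hom[OF cover_regular_epi.hyps(1)]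
  have "Comp C (Comp C u c) e = Comp C (Comp C v c) e"
    using cover_regular_epi.prems comp_assoc[OF cover_regular_epi.hyps(2) c] by metis
  then have "Comp C u c = Comp C v c"
    using regular_epi_cancel[OF cover_regular_epi.hyps(3,2)] comp_hom[OF c] cover_regular_epi.prems
    by blast
  then show ?case using cover_regular_epi by blast
qed

text \<open>The induction runs over \<open>c'\<close>, because covers grow by regular epimorphisms
  at the domain end.\<close>

lemma cover_trans:
  assumes "cover C T T' c'" "cover C S T c"
  shows "cover C S T' (Comp C c c')"
  using assms
proof (induction rule: cover.induct)
  case cover_ident
  then show ?case using comp_ident_right cover_hom by metis
next
  case (cover_regular_epi T1 c1 e T2)
  then show ?case
    using comp_assoc[OF cover_regular_epi.hyps(2) cover_hom cover_hom] cover.cover_regular_epi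
    by metis
qed

text \<open>Substitute for choosing a preimage of \<open>s\<close> under \<open>e\<close>: the
  pullback of \<open>e\<close> along \<open>s\<close> carries the lift, and stability makes its
  other leg a regular epimorphism.\<close>

lemma regular_epi_lift:
  assumes e: "regular_epi C e" "e \<in> hom C A B" and s: "s \<in> hom C T B"
  obtains T' e' t where "regular_epi C e'" "e' \<in> hom C T' T" "t \<in> hom C T' A"
    "Comp C e t = Comp C s e'"
proof -
  obtain T' t e' where pb: "is_pullback C e s t e'" "t \<in> hom C T' A" "e' \<in> hom C T' T"
    using pullback_exists[OF e(2) s] .
  moreover have "Comp C e t = Comp C s e'" using pb(1) by (simp add: is_pullback_def)
  ultimately show thesis using that regular_epi_pullback e(1) by blast
qed

lemma cover_lift:
  assumes "cover C S T c" "s \<in> hom C S' S"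
  obtains T' c' t where "cover C S' T' c'" "t \<in> hom C T' T" "Comp C c t = Comp C s c'"
  using assms
proof (induction arbitrary: thesis rule: cover.induct)
  case cover_ident
  have S': "S' \<in> Obj C" using hom_obj(1) cover_ident.prems(2) .
  show ?case
    using cover_ident.prems(1)[OF cover.cover_ident[OF S'] cover_ident.prems(2)]
      comp_ident_left comp_ident_right cover_ident.prems(2) by metis
next
  case (cover_regular_epi T c e T')
  note c = cover_hom[OF cover_regular_epi.hyps(1)]
  obtain U c' t where 1: "cover C S' U c'" "t \<in> hom C U T" "Comp C c t = Comp C s c'"
    using cover_regular_epi.IH[OF _ cover_regular_epi.prems(2)] by blast
  obtain V e' w where 2: "regular_epi C e'" "e' \<in> hom C V U" "w \<in> hom C V T'"
    "Comp C e w = Comp C t e'"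
    using regular_epi_lift[OF cover_regular_epi.hyps(3,2) 1(2)] .
  have "Comp C (Comp C c e) w = Comp C c (Comp C t e')"
    using comp_assoc[OF 2(3) cover_regular_epi.hyps(2) c] 2(4) by simp
  also have "\<dots> = Comp C s (Comp C c' e')"
    using comp_assoc[OF 2(2) 1(2) c] comp_assoc[OF 2(2) cover_hom[OF 1(1)] cover_regular_epi.prems(2)] 1(3)
    by simp
  finally show ?case
    using cover_regular_epi.prems(1)[OF cover.cover_regular_epi[OF 1(1) 2(2,1)] 2(3)] by blast
qed

text \<open>Lifting \<open>c2\<close> along \<open>c1\<close> yields a common refinement.\<close>

lemma common_cover:
  assumes "cover C S T1 c1" "cover C S T2 c2"
  obtains T t1 t2 where "t1 \<in> hom C T T1" "t2 \<in> hom C T T2"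
    "Comp C c1 t1 = Comp C c2 t2" "cover C S T (Comp C c1 t1)"
proof -
  obtain T c' t where 1: "cover C T2 T c'" "t \<in> hom C T T1" "Comp C c1 t = Comp C c2 c'"
    using cover_lift[OF assms(1) cover_hom[OF assms(2)]] .
  show thesis
    using that[OF 1(2) cover_hom[OF 1(1)] 1(3)] cover_trans[OF 1(1) assms(2)] 1(3) by simp
qed

text \<open>\<open>e\<close> is the coequaliser of the kernel pair of \<open>f\<close>. To see that
  \<open>m\<close> is monic, two arrows into \<open>Q\<close> identified by \<open>m\<close> are
  lifted, on a cover, to arrows into \<open>A\<close>. These are identified by \<open>f\<close>, so
  together they factor through the kernel pair and are identified by \<open>e\<close>; the cover is
  then cancelled.\<close>

lemma image_factorization:
  assumes f: "f \<in> hom C A B"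
  obtains Q e m where "regular_epi C e" "e \<in> hom C A Q" "m \<in> hom C Q B" "monic C m" "Comp C m e = f"
proof -
  obtain K p q where pb: "is_pullback C f f p q" and p: "p \<in> hom C K A" and q: "q \<in> hom C K A"
    using pullback_exists[OF f f] .
  obtain e where e: "is_coequaliser C p q e"
    using kernel_pair_coequaliser pb unfolding is_kernel_pair_def by blast
  then have re: "regular_epi C e" by (auto simp: regular_epi_def)
  obtain Q where eh: "e \<in> hom C A Q" and epq: "Comp C e p = Comp C e q"
    using e p by (auto simp: is_coequaliser_def hom_def)
  have "Comp C f p = Comp C f q" using pb by (simp add: is_pullback_def)
  then obtain m where m: "m \<in> hom C Q B" "Comp C m e = f"
    using e f homD[OF p] homD[OF eh] unfolding is_coequaliser_def by blast
  have "u = v" if u: "u \<in> hom C T Q" and v: "v \<in> hom C T Q" and uv: "Comp C m u = Comp C m v" for T u v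
  proof -
    have T: "T \<in> Obj C" using hom_obj(1)[OF u] .
    obtain T1 e1 w1 where 1: "regular_epi C e1" "e1 \<in> hom C T1 T" "w1 \<in> hom C T1 A"
      "Comp C e w1 = Comp C u e1"
      using regular_epi_lift[OF re eh u] .
    obtain T2 e2 w2 where 2: "regular_epi C e2" "e2 \<in> hom C T2 T1" "w2 \<in> hom C T2 A"
      "Comp C e w2 = Comp C (Comp C v e1) e2"
      using regular_epi_lift[OF re eh comp_hom[OF 1(2) v]] .
    let ?c = "Comp C e1 e2" and ?w1 = "Comp C w1 e2"
    have c: "?c \<in> hom C T2 T" and w1: "?w1 \<in> hom C T2 A"
      using comp_hom[OF 2(2) 1(2)] comp_hom[OF 2(2) 1(3)] by auto
    have ew1: "Comp C e ?w1 = Comp C u ?c"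
      using comp_assoc[OF 2(2) 1(3) eh] comp_assoc[OF 2(2) 1(2) u] 1(4) by simp
    have ew2: "Comp C e w2 = Comp C v ?c"
      using comp_assoc[OF 2(2) 1(2) v] 2(4) by simp
    have "Comp C f ?w1 = Comp C m (Comp C u ?c)"
      using comp_assoc[OF w1 eh m(1)] ew1 m(2) by simp
    also have "\<dots> = Comp C m (Comp C v ?c)"
      using comp_assoc[OF c u m(1)] comp_assoc[OF c v m(1)] uv by simp
    also have "\<dots> = Comp C f w2"
      using comp_assoc[OF 2(3) eh m(1)] ew2 m(2) by simp
    finally have "\<exists>h. h \<in> hom C T2 K \<and> Comp C p h = ?w1 \<and> Comp C q h = w2"
      using pb w1 2(3) homD[OF f] homD[OF p] unfolding is_pullback_def by blast
    then obtain h where h: "h \<in> hom C T2 K" "Comp C p h = ?w1" "Comp C q h = w2" by blast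
    have "Comp C e ?w1 = Comp C e w2"
      using comp_assoc[OF h(1) p eh] comp_assoc[OF h(1) q eh] epq h(2,3) by simp
    then have "Comp C u ?c = Comp C v ?c" using ew1 ew2 by simp
    moreover have "cover C T T2 ?c"
      using cover_regular_epi[OF cover_regular_epi[OF cover_ident[OF T] 1(2,1)] 2(2,1)]
        comp_ident_left[OF 1(2)] by simp
    ultimately show "u = v" using cover_cancel u v by blast
  qed
  then have "monic C m" using homD[OF m(1)] by (auto simp: monic_def)
  with that re eh m show thesis by blast
qed

text \<open>Regular epimorphisms are orthogonal to jointly monic families: \<open>h\<close>
  coequalises the pair defining \<open>e\<close>, because it does so after each \<open>r i\<close>,
  and hence factors through \<open>e\<close>. The induction removes the regular epimorphisms one at
  a time, beginning at the domain end.\<close>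

lemma jointly_monic_descend:
  assumes jm: "jointly_monic C I X R r" and "cover C S T c"
    and "\<forall>i\<in>I. y i \<in> hom C S (X i)"
    and "h \<in> hom C T R" "\<forall>i\<in>I. Comp C (r i) h = Comp C (y i) c"
  shows "\<exists>u \<in> hom C S R. \<forall>i\<in>I. Comp C (r i) u = y i"
  using assms(2-)
proof (induction arbitrary: h rule: cover.induct)
  case cover_ident
  have "Comp C (r i) h = y i" if "i \<in> I" for i
    using that cover_ident.prems(3) comp_ident_right[OF cover_ident.prems(1)[rule_format, OF that]]
    by simp
  then show ?case using cover_ident.prems(2) by blast
next
  case (cover_regular_epi T c e T')
  note c = cover_hom[OF cover_regular_epi.hyps(1)]
  note e = cover_regular_epi.hyps(2) and y = cover_regular_epi.prems(1)[rule_format]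
    and h = cover_regular_epi.prems(2)
  obtain f g where co: "is_coequaliser C f g e"
    using cover_regular_epi.hyps(3) by (auto simp: regular_epi_def)
  define U where "U = Dom C f"
  have f: "f \<in> hom C U T'" and g: "g \<in> hom C U T'" and efg: "Comp C e f = Comp C e g"
    and ce: "Cod C f = T'" "Cod C e = T"
    using co homD[OF e] by (auto simp: is_coequaliser_def hom_def U_def)
  have rh: "Comp C (r i) h = Comp C (Comp C (y i) c) e" if "i \<in> I" for i
    using cover_regular_epi.prems(3) that comp_assoc[OF e c y[OF that]] by simp
  have "Comp C h f = Comp C h g"
  proof (rule jointly_monicD[OF jm comp_hom[OF f h] comp_hom[OF g h]])
    fix i assume i: "i \<in> I"
    note ri = jointly_monic_hom[OF jm i] and yc = comp_hom[OF c y[OF i]]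
    show "Comp C (r i) (Comp C h f) = Comp C (r i) (Comp C h g)"
      using comp_assoc[OF f h ri] comp_assoc[OF g h ri] rh[OF i]
        comp_assoc[OF f e yc] comp_assoc[OF g e yc] efg by simp
  qed
  then obtain u where u: "u \<in> hom C T R" "Comp C u e = h"
    using co h ce unfolding is_coequaliser_def by blast
  have "\<forall>i\<in>I. Comp C (r i) u = Comp C (y i) c"
  proof (rule ballI, rule regular_epi_cancel[OF cover_regular_epi.hyps(3) e])
    fix i assume i: "i \<in> I"
    note ri = jointly_monic_hom[OF jm i]
    show "Comp C (r i) u \<in> hom C T (X i)" "Comp C (y i) c \<in> hom C T (X i)"
      using comp_hom[OF u(1) ri] comp_hom[OF c y[OF i]] by auto
    show "Comp C (Comp C (r i) u) e = Comp C (Comp C (y i) c) e"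
      using comp_assoc[OF e u(1) ri] u(2) rh[OF i] by simp
  qed
  then show ?case using cover_regular_epi.IH[OF cover_regular_epi.prems(1) u(1)] by blast
qed

section \<open>The Baker--Pixley argument\<close>

text \<open>The tuple \<open>y\<close> lies in the image of the projection of the relation \<open>r\<close> to the
  coordinates in \<open>I\<close>.\<close>

definition locally_in :: "'o \<Rightarrow> (nat \<Rightarrow> 'a) \<Rightarrow> 'o \<Rightarrow> (nat \<Rightarrow> 'a) \<Rightarrow> nat set \<Rightarrow> bool" where
  "locally_in R r S y I \<longleftrightarrow>
    (\<exists>T c h. cover C S T c \<and> h \<in> hom C T R \<and> (\<forall>i\<in>I. Comp C (r i) h = Comp C (y i) c))"

lemma locally_in_mono: "locally_in R r S y I \<Longrightarrow> J \<subseteq> I \<Longrightarrow> locally_in R r S y J"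
  unfolding locally_in_def by blast

lemma locally_in_refine:
  assumes c: "cover C S T c" and h: "h \<in> hom C T R" "\<forall>i\<in>I. Comp C (r i) h = Comp C (y i) c"
    and t: "t \<in> hom C T' T" and r: "\<And>i. i \<in> I \<Longrightarrow> r i \<in> hom C R (X i)"
    and y: "\<And>i. i \<in> I \<Longrightarrow> y i \<in> hom C S (X i)" and i: "i \<in> I"
  shows "Comp C (r i) (Comp C h t) = Comp C (y i) (Comp C c t)"
  using comp_assoc[OF t h(1) r[OF i]] comp_assoc[OF t cover_hom[OF c] y[OF i]] h(2) i by simp

text \<open>The three columns of \<open>Maj\<close> must be interpreted over one object, so the
  three witnesses are restricted to a common refinement of their covers.\<close>

lemma locally_in_common:
  assumes "locally_in R r S y I" "locally_in R r S y J" "locally_in R r S y K"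
    and r: "\<And>i. i \<in> I \<union> J \<union> K \<Longrightarrow> r i \<in> hom C R (X i)"
    and y: "\<And>i. i \<in> I \<union> J \<union> K \<Longrightarrow> y i \<in> hom C S (X i)"
  obtains T c h1 h2 h3 where "cover C S T c"
    "h1 \<in> hom C T R" "\<forall>i\<in>I. Comp C (r i) h1 = Comp C (y i) c"
    "h2 \<in> hom C T R" "\<forall>i\<in>J. Comp C (r i) h2 = Comp C (y i) c"
    "h3 \<in> hom C T R" "\<forall>i\<in>K. Comp C (r i) h3 = Comp C (y i) c"
proof -
  obtain T1 c1 h1 where 1: "cover C S T1 c1" "h1 \<in> hom C T1 R" "\<forall>i\<in>I. Comp C (r i) h1 = Comp C (y i) c1"
    using assms(1) unfolding locally_in_def by blast
  obtain T2 c2 h2 where 2: "cover C S T2 c2" "h2 \<in> hom C T2 R" "\<forall>i\<in>J. Comp C (r i) h2 = Comp C (y i) c2"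
    using assms(2) unfolding locally_in_def by blast
  obtain T3 c3 h3 where 3: "cover C S T3 c3" "h3 \<in> hom C T3 R" "\<forall>i\<in>K. Comp C (r i) h3 = Comp C (y i) c3"
    using assms(3) unfolding locally_in_def by blast
  obtain U a1 a2 where a: "a1 \<in> hom C U T1" "a2 \<in> hom C U T2"
    "Comp C c1 a1 = Comp C c2 a2" "cover C S U (Comp C c1 a1)"
    using common_cover[OF 1(1) 2(1)] .
  obtain V b3 b where b: "b \<in> hom C V U" "b3 \<in> hom C V T3"
    "Comp C (Comp C c1 a1) b = Comp C c3 b3" "cover C S V (Comp C (Comp C c1 a1) b)"
    using common_cover[OF a(4) 3(1)] by blast
  note c1 = cover_hom[OF 1(1)] and c2 = cover_hom[OF 2(1)]
  have e1: "Comp C (Comp C c1 a1) b = Comp C c1 (Comp C a1 b)" using comp_assoc[OF b(1) a(1) c1] .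
  have e2: "Comp C (Comp C c1 a1) b = Comp C c2 (Comp C a2 b)" using comp_assoc[OF b(1) a(2) c2] a(3) by simp
  show thesis
  proof (rule that[OF b(4)])
    show "Comp C h1 (Comp C a1 b) \<in> hom C V R" "Comp C h2 (Comp C a2 b) \<in> hom C V R" "Comp C h3 b3 \<in> hom C V R"
      using comp_hom a b 1 2 3 by blast+
    show "\<forall>i\<in>I. Comp C (r i) (Comp C h1 (Comp C a1 b)) = Comp C (y i) (Comp C (Comp C c1 a1) b)"
      unfolding e1 using locally_in_refine[OF 1 comp_hom[OF b(1) a(1)], of X] r y by blast
    show "\<forall>i\<in>J. Comp C (r i) (Comp C h2 (Comp C a2 b)) = Comp C (y i) (Comp C (Comp C c1 a1) b)"
      unfolding e2 using locally_in_refine[OF 2 comp_hom[OF b(1) a(2)], of X] r y by blast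
    show "\<forall>i\<in>K. Comp C (r i) (Comp C h3 b3) = Comp C (y i) (Comp C (Comp C c1 a1) b)"
      unfolding b(3) using locally_in_refine[OF 3 b(2), of X] r y by blast
  qed
qed

text \<open>\<open>Maj\<close> is applied to the image of the relation in the product of the three objects
  \<open>X a\<close>, \<open>X b\<close> and \<open>D = (\<Prod>i\<in>I. X i)\<close>.\<close>

lemma locally_in_step:
  assumes Maj: "closed_families C Maj" and I: "finite I"
    and r: "\<And>i. i \<in> insert a (insert b I) \<Longrightarrow> r i \<in> hom C R (X i)"
    and y: "\<And>i. i \<in> insert a (insert b I) \<Longrightarrow> y i \<in> hom C S (X i)"
    and R: "R \<in> Obj C" and S: "S \<in> Obj C"
    and la: "locally_in R r S y (insert a I)" and lb: "locally_in R r S y (insert b I)"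
    and lab: "locally_in R r S y {a, b}"
  shows "locally_in R r S y (insert a (insert b I))"
proof -
  obtain T c h1 h2 h3 where c: "cover C S T c"
    and h1: "h1 \<in> hom C T R" "\<forall>i\<in>{a, b}. Comp C (r i) h1 = Comp C (y i) c"
    and h2: "h2 \<in> hom C T R" "\<forall>i\<in>insert a I. Comp C (r i) h2 = Comp C (y i) c"
    and h3: "h3 \<in> hom C T R" "\<forall>i\<in>insert b I. Comp C (r i) h3 = Comp C (y i) c"
    by (rule locally_in_common[OF lab la lb, of X]) (use r y in auto)
  note ch = cover_hom[OF c]
  have T: "T \<in> Obj C" using hom_obj(1)[OF ch] .
  obtain D \<pi> where D: "product_over C I X D \<pi>"
    using product_exists[OF I, of X] r hom_obj(2) by blast
  note \<pi> = product_over_proj[OF D]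
  obtain rD where rD: "rD \<in> hom C R D" "\<And>i. i \<in> I \<Longrightarrow> Comp C (\<pi> i) rD = r i"
    by (rule product_over_tuple[OF D R, of r]) (use r in auto)
  obtain yD where yD: "yD \<in> hom C S D" "\<And>i. i \<in> I \<Longrightarrow> Comp C (\<pi> i) yD = y i"
    by (rule product_over_tuple[OF D S, of y]) (use y in auto)
  define X' where "X' = (\<lambda>q::nat. if q = 0 then X a else if q = 1 then X b else D)"
  define r' where "r' = (\<lambda>q::nat. if q = 0 then r a else if q = 1 then r b else rD)"
  define y' where "y' = (\<lambda>q::nat. if q = 0 then y a else if q = 1 then y b else yD)"
  have r': "r' q \<in> hom C R (X' q)" and y': "y' q \<in> hom C S (X' q)" for q
    using r y rD yD by (auto simp: r'_def y'_def X'_def)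
  have X': "X' q \<in> Obj C" for q using hom_obj(2)[OF r'] .
  obtain P p where P: "product_over C {..<3} X' P p" using product_exists[of "{..<3}" X'] X' by auto
  obtain \<rho> where \<rho>: "\<rho> \<in> hom C R P" "\<And>q. q \<in> {..<3} \<Longrightarrow> Comp C (p q) \<rho> = r' q"
    by (rule product_over_tuple[OF P R, of r']) (use r' in auto)
  \<comment> \<open>The family \<open>r'\<close> forgets all coordinates outside \<open>a\<close>,
    \<open>b\<close> and \<open>I\<close> and need not be jointly monic; \<open>Maj\<close> can only
    be applied to its image.\<close>
  obtain Q e m where e: "regular_epi C e" "e \<in> hom C R Q" and m: "m \<in> hom C Q P" "monic C m"
    and me: "Comp C m e = \<rho>"
    using image_factorization[OF \<rho>(1)] .
  let ?m = "\<lambda>q. Comp C (p q) m"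
  have jm: "jointly_monic C {..<3} X' Q ?m" using monic_jointly_monic[OF P m(1)] m(2) by blast
  note mh = jointly_monic_hom[OF jm]
  have me': "Comp C (?m q) e = r' q" if "q \<in> {..<3}" for q
    using comp_assoc[OF e(2) m(1) product_over_proj[OF P that]] me \<rho>(2)[OF that] by simp
  have meh: "Comp C (?m q) (Comp C e h) = Comp C (r' q) h" if "q < 3" "h \<in> hom C U R" for q h U
    using comp_assoc[OF that(2) e(2) mh] me' that(1) by simp
  have D_eq: "Comp C rD h = Comp C yD d" if "h \<in> hom C U R" "d \<in> hom C U S"
    "\<forall>i\<in>I. Comp C (r i) h = Comp C (y i) d" for h d U
  proof (rule product_over_eqI[OF D comp_hom[OF that(1) rD(1)] comp_hom[OF that(2) yD(1)]])
    fix i assume i: "i \<in> I"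
    show "Comp C (\<pi> i) (Comp C rD h) = Comp C (\<pi> i) (Comp C yD d)"
      using comp_assoc[OF that(1) rD(1) \<pi>[OF i]] comp_assoc[OF that(2) yD(1) \<pi>[OF i]]
        rD(2)[OF i] yD(2)[OF i] that(3) i by simp
  qed
  \<comment> \<open>\<open>f\<close> is the wanted tuple. \<open>g q\<close> comes from the one
    witness not known to agree with it in row \<open>q\<close>: \<open>h3\<close> may fail at
    \<open>a\<close>, \<open>h2\<close> at \<open>b\<close>, \<open>h1\<close> on
    \<open>I\<close>.\<close>
  define f where "f = (\<lambda>q. Comp C (y' q) c)"
  define g where "g = (\<lambda>q::nat. Comp C (r' q) (if q = 0 then h3 else if q = 1 then h2 else h1))"
  have "\<exists>h \<in> hom C T Q. \<forall>q<3. Comp C (?m q) h = (if q = 2 - j then g q else f q)" if "j < 3" for j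
  proof (rule bexI[of _ "Comp C e (if j = 0 then h1 else if j = 1 then h2 else h3)"])
    show "\<forall>q<3. Comp C (?m q) (Comp C e (if j = 0 then h1 else if j = 1 then h2 else h3)) =
        (if q = 2 - j then g q else f q)"
      using that h1 h2 h3 meh[OF _ h1(1)] meh[OF _ h2(1)] meh[OF _ h3(1)]
        D_eq[OF h2(1) ch] D_eq[OF h3(1) ch]
      by (auto simp: less_3_iff f_def g_def r'_def y'_def)
    show "Comp C e (if j = 0 then h1 else if j = 1 then h2 else h3) \<in> hom C T Q"
      using comp_hom[OF h1(1) e(2)] comp_hom[OF h2(1) e(2)] comp_hom[OF h3(1) e(2)] by auto
  qed
  moreover have "f q \<in> hom C T (X' q) \<and> g q \<in> hom C T (X' q)" for q
    using comp_hom[OF ch y'] comp_hom[OF h1(1) r'] comp_hom[OF h2(1) r'] comp_hom[OF h3(1) r']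
    by (auto simp: f_def g_def)
  ultimately have "\<exists>h \<in> hom C T Q. \<forall>q<3. Comp C (?m q) h = f q"
    using Maj jm T X' unfolding closed_families_Maj_iff by blast
  then obtain z where z: "z \<in> hom C T Q" "\<And>q. q < 3 \<Longrightarrow> Comp C (?m q) z = Comp C (y' q) c"
    unfolding f_def by blast
  \<comment> \<open>The member \<open>z\<close> found by \<open>Maj\<close> lies in the image only;
    lifting it to \<open>R\<close> costs one more regular epimorphism.\<close>
  obtain T' e' t where e': "regular_epi C e'" "e' \<in> hom C T' T" and t: "t \<in> hom C T' R"
    and et: "Comp C e t = Comp C z e'"
    using regular_epi_lift[OF e z(1)] .
  let ?d = "Comp C c e'"
  have d: "cover C S T' ?d" using cover_regular_epi[OF c e'(2,1)] .
  have rt: "Comp C (r' q) t = Comp C (y' q) ?d" if "q < 3" for q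
  proof -
    have "Comp C (r' q) t = Comp C (?m q) (Comp C z e')" using meh[OF that t] et by simp
    also have "\<dots> = Comp C (Comp C (y' q) c) e'" using comp_assoc[OF e'(2) z(1) mh] z(2) that by simp
    also have "\<dots> = Comp C (y' q) ?d" using comp_assoc[OF e'(2) ch y'] .
    finally show ?thesis .
  qed
  have "Comp C (r i) t = Comp C (y i) ?d" if "i \<in> insert a (insert b I)" for i
  proof (cases "i \<in> I")
    case True
    have "Comp C rD t = Comp C yD ?d" using rt[of 2] by (simp add: r'_def y'_def)
    then show ?thesis
      using comp_assoc[OF t rD(1) \<pi>[OF True]] comp_assoc[OF cover_hom[OF d] yD(1) \<pi>[OF True]]
        rD(2)[OF True] yD(2)[OF True] by simp
  next
    case False
    then show ?thesis using that rt[of 0] rt[of 1] by (auto simp: r'_def y'_def)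
  qed
  with d t show ?thesis unfolding locally_in_def by blast
qed

text \<open>Of a set with more than two coordinates, remove \<open>b\<close>, remove
  \<open>a\<close>, or keep only \<open>a\<close> and \<open>b\<close>. Every coordinate survives in
  at least two of these three smaller sets, which is the pattern of the columns of
  \<open>Maj\<close>.\<close>

lemma Baker_Pixley:
  assumes Maj: "closed_families C Maj" and R: "R \<in> Obj C" and S: "S \<in> Obj C"
    and r: "\<And>i. i \<in> N \<Longrightarrow> r i \<in> hom C R (X i)" and y: "\<And>i. i \<in> N \<Longrightarrow> y i \<in> hom C S (X i)"
    and pairs: "\<And>i j. i \<in> N \<Longrightarrow> j \<in> N \<Longrightarrow> locally_in R r S y {i, j}"
    and N: "finite N" "N \<noteq> {}"
  shows "locally_in R r S y N"
proof -
  have "locally_in R r S y I" if "finite I" "I \<subseteq> N" for I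
    using that
  proof (induction rule: finite_psubset_induct)
    case (psubset I)
    show ?case
    \<comment> \<open>The pair is taken from \<open>N\<close> and may have \<open>a = b\<close>, so
      sets with fewer than two coordinates, including the empty one, are base cases too.\<close>
    proof (cases "\<exists>a b. a \<in> N \<and> b \<in> N \<and> I \<subseteq> {a, b}")
      case True
      then show ?thesis using pairs locally_in_mono by meson
    next
      case False
      then obtain a where a: "a \<in> I" using N(2) by blast
      then obtain b where b: "b \<in> I" "b \<noteq> a" using False psubset.prems by blast
      let ?J = "I - {a, b}"
      have J: "insert a (insert b ?J) = I" using a b by blast
      have sub: "insert a ?J \<subset> I" "insert b ?J \<subset> I" using a b by auto
      have ab: "a \<in> N" "b \<in> N" using a b psubset.prems by blast+
      have loc: "locally_in R r S y (insert a ?J)" "locally_in R r S y (insert b ?J)"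
        using psubset.IH sub psubset.prems by (meson order.trans psubset_imp_subset)+
      have fin: "finite ?J" using psubset.hyps by blast
      have ry: "r i \<in> hom C R (X i)" "y i \<in> hom C S (X i)" if "i \<in> insert a (insert b ?J)" for i
        using that r y ab psubset.prems by blast+
      have "locally_in R r S y (insert a (insert b ?J))"
        by (rule locally_in_step[OF Maj fin ry R S loc pairs[OF ab]])
      then show ?thesis using J by simp
    qed
  qed
  with N show ?thesis by blast
qed

text \<open>A left column agreeing with the right one in rows \<open>i\<close> and \<open>j\<close>
  proves membership for these two coordinates over the identity cover.\<close>

lemma closed_families_if_pairwise_agreeing:
  assumes Maj: "closed_families C Maj" and M: "pairwise_agreeing M"
  shows "closed_families C M"
  unfolding closed_families_def
proof (intro allI impI, elim conjE)
  fix n m k X S R r f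
  assume Mn: "M \<in> matr_nmk n m k" and S: "S \<in> Obj C" and jm: "jointly_monic C {..<n} X R r"
    and f: "\<forall>i<n. \<forall>v\<in>{1..k}. f i v \<in> hom C S (X i)"
    and left: "\<forall>l<m. \<exists>h \<in> hom C S R. \<forall>i<n. Comp C (r i) h = f i (M $$ (i, l))"
  define y where "y = (\<lambda>i. f i (M $$ (i, m)))"
  have y: "y i \<in> hom C S (X i)" if "i \<in> {..<n}" for i
    using f that matr_nmk_entry[OF Mn, of i m] by (simp add: y_def)
  have dim: "dim_row M = n" "dim_col M - 1 = m" "n > 0" using Mn by (auto simp: matr_nmk_def)
  have R: "R \<in> Obj C" using jm by (simp add: jointly_monic_def)
  have "locally_in R r S y {..<n}"
  proof (rule Baker_Pixley[OF Maj R S jointly_monic_hom[OF jm] y])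
    fix i j assume ij: "i \<in> {..<n}" "j \<in> {..<n}"
    then obtain l where l: "l < m" "M $$ (i, l) = M $$ (i, m)" "M $$ (j, l) = M $$ (j, m)"
      using M dim unfolding pairwise_agreeing_def by auto
    then obtain h where h: "h \<in> hom C S R" "\<forall>i<n. Comp C (r i) h = f i (M $$ (i, l))"
      using left by blast
    have "\<forall>q\<in>{i, j}. Comp C (r q) h = Comp C (y q) (Ident C S)"
      using ij h(2) l comp_ident_right[OF y] by (auto simp: y_def)
    then show "locally_in R r S y {i, j}"
      using cover_ident[OF S] h(1) unfolding locally_in_def by blast
  qed (use dim in auto)
  then obtain T c h where "cover C S T c" "h \<in> hom C T R" "\<forall>i\<in>{..<n}. Comp C (r i) h = Comp C (y i) c"
    unfolding locally_in_def by blast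
  then have "\<exists>u \<in> hom C S R. \<forall>i\<in>{..<n}. Comp C (r i) u = y i"
    using jointly_monic_descend[OF jm] y by blast
  then show "\<exists>h \<in> hom C S R. \<forall>i<n. Comp C (r i) h = f i (M $$ (i, m))"
    by (auto simp: y_def)
qed

end

lemma implies_reg_Maj:
  assumes "pairwise_agreeing M"
  shows "implies_reg T Maj M"
  unfolding implies_reg_def
proof (intro allI impI, elim conjE)
  fix C :: "('c, 'd) cat" assume C: "regular_category C" "closed_relations C Maj"
  then interpret regular_cat C
    by (auto simp: regular_category_def regular_cat_def regular_cat_axioms_def
        lex_category_def lex_category_axioms_def finitely_complete_def)
  show "closed_relations C M"
    using closed_families_if_pairwise_agreeing[OF _ assms] C(2) closed_relations_iff_families by blast
qed

section \<open>The category of finite majority algebras\<close>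

definition majority_on :: "'x set \<Rightarrow> ('x \<Rightarrow> 'x \<Rightarrow> 'x \<Rightarrow> 'x) \<Rightarrow> bool" where
  "majority_on A m \<longleftrightarrow> (\<forall>x\<in>A. \<forall>y\<in>A. \<forall>z\<in>A. m x y z \<in> A) \<and>
     (\<forall>x\<in>A. \<forall>y\<in>A. m x x y = x \<and> m x y x = x \<and> m y x x = x)"

definition ternary_hom ::
  "'x set \<Rightarrow> ('x \<Rightarrow> 'x \<Rightarrow> 'x \<Rightarrow> 'x) \<Rightarrow> 'y set \<Rightarrow> ('y \<Rightarrow> 'y \<Rightarrow> 'y \<Rightarrow> 'y) \<Rightarrow> ('x \<Rightarrow> 'y) \<Rightarrow> bool" where
  "ternary_hom A m B n h \<longleftrightarrow> (\<forall>x\<in>A. h x \<in> B) \<and>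
     (\<forall>x\<in>A. \<forall>y\<in>A. \<forall>z\<in>A. h (m x y z) = n (h x) (h y) (h z))"

lemma ternary_homD:
  assumes "ternary_hom A m B n h"
  shows "x \<in> A \<Longrightarrow> h x \<in> B"
    "x \<in> A \<Longrightarrow> y \<in> A \<Longrightarrow> z \<in> A \<Longrightarrow> h (m x y z) = n (h x) (h y) (h z)"
  using assms by (auto simp: ternary_hom_def)

lemma majority_onD:
  assumes "majority_on A m"
  shows "x \<in> A \<Longrightarrow> y \<in> A \<Longrightarrow> z \<in> A \<Longrightarrow> m x y z \<in> A"
    "x \<in> A \<Longrightarrow> y \<in> A \<Longrightarrow> m x x y = x"
    "x \<in> A \<Longrightarrow> y \<in> A \<Longrightarrow> m x y x = x"
    "x \<in> A \<Longrightarrow> y \<in> A \<Longrightarrow> m y x x = x"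
  using assms by (auto simp: majority_on_def)

lemma majority_on_idem: "majority_on A m \<Longrightarrow> x \<in> A \<Longrightarrow> m x x x = x"
  by (simp add: majority_on_def)

text \<open>Only decoding functions are mentioned, so the types of objects and arrows stay
  arbitrary: \<open>sz\<close> is the size of the carrier, \<open>maj\<close> the operation,
  \<open>fn\<close> the underlying map. The axioms demand all homomorphisms and, up to isomorphism,
  all finite majority algebras. The empty algebra is among them, as an equaliser may be
  empty.\<close>

locale majority_algebras = category C for C :: "('o, 'a) cat" +
  fixes sz :: "'o \<Rightarrow> nat" and maj :: "'o \<Rightarrow> nat \<Rightarrow> nat \<Rightarrow> nat \<Rightarrow> nat" and fn :: "'a \<Rightarrow> nat \<Rightarrow> nat"
  assumes majority_obj: "A \<in> Obj C \<Longrightarrow> majority_on {..<sz A} (maj A)"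
    and ternary_hom_fn: "f \<in> hom C A B \<Longrightarrow> ternary_hom {..<sz A} (maj A) {..<sz B} (maj B) (fn f)"
    and hom_exists: "A \<in> Obj C \<Longrightarrow> B \<in> Obj C \<Longrightarrow>
      ternary_hom {..<sz A} (maj A) {..<sz B} (maj B) h \<Longrightarrow> \<exists>f \<in> hom C A B. \<forall>x<sz A. fn f x = h x"
    and hom_eqI: "f \<in> hom C A B \<Longrightarrow> g \<in> hom C A B \<Longrightarrow> (\<And>x. x < sz A \<Longrightarrow> fn f x = fn g x) \<Longrightarrow> f = g"
    and fn_comp: "f \<in> hom C A B \<Longrightarrow> g \<in> hom C B D \<Longrightarrow> x < sz A \<Longrightarrow> fn (Comp C g f) x = fn g (fn f x)"
    and fn_ident: "A \<in> Obj C \<Longrightarrow> x < sz A \<Longrightarrow> fn (Ident C A) x = x"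
    and obj_exists: "majority_on {..<d} m \<Longrightarrow>
      \<exists>A \<in> Obj C. sz A = d \<and> (\<forall>x<d. \<forall>y<d. \<forall>z<d. maj A x y z = m x y z)"
begin

lemma fn_less: "f \<in> hom C A B \<Longrightarrow> x < sz A \<Longrightarrow> fn f x < sz B"
  using ternary_homD(1)[OF ternary_hom_fn] by auto

lemma fn_maj: "f \<in> hom C A B \<Longrightarrow> x < sz A \<Longrightarrow> y < sz A \<Longrightarrow> z < sz A \<Longrightarrow>
    fn f (maj A x y z) = maj B (fn f x) (fn f y) (fn f z)"
  using ternary_homD(2)[OF ternary_hom_fn] by auto

lemma maj_less: "A \<in> Obj C \<Longrightarrow> x < sz A \<Longrightarrow> y < sz A \<Longrightarrow> z < sz A \<Longrightarrow> maj A x y z < sz A"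
  using majority_onD(1)[OF majority_obj] by auto

lemma hom_eq_iff:
  "f \<in> hom C A B \<Longrightarrow> g \<in> hom C A B \<Longrightarrow> f = g \<longleftrightarrow> (\<forall>x<sz A. fn f x = fn g x)"
  using hom_eqI by blast

lemma hom_exists':
  assumes "A \<in> Obj C" "B \<in> Obj C" "\<And>x. x < sz A \<Longrightarrow> h x < sz B"
    "\<And>x y z. x < sz A \<Longrightarrow> y < sz A \<Longrightarrow> z < sz A \<Longrightarrow> h (maj A x y z) = maj B (h x) (h y) (h z)"
  obtains f where "f \<in> hom C A B" "\<And>x. x < sz A \<Longrightarrow> fn f x = h x"
  using hom_exists[OF assms(1,2), of h] assms(3,4) by (auto simp: ternary_hom_def)

text \<open>Transport along an enumeration of \<open>D\<close>, with \<open>b\<close> decoding and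
  \<open>c\<close> encoding. Limits, images and the order relation are naturally sets of functions,
  subsets and sets of pairs, and become objects in this way.\<close>

lemma algebra_exists:
  assumes D: "finite D" and m: "majority_on D m"
  obtains A b c where "A \<in> Obj C" "ternary_hom {..<sz A} (maj A) D m b"
    "ternary_hom D m {..<sz A} (maj A) c"
    "\<And>x. x < sz A \<Longrightarrow> c (b x) = x" "\<And>x. x \<in> D \<Longrightarrow> b (c x) = x"
proof -
  obtain b where b: "bij_betw b {..<card D} D"
    using ex_bij_betw_nat_finite[OF D] by (auto simp: atLeast0LessThan)
  define c where "c = inv_into {..<card D} b"
  have c: "bij_betw c D {..<card D}" using bij_betw_inv_into[OF b] by (simp add: c_def)
  have cb: "c (b x) = x" if "x < card D" for x
    using bij_betw_inv_into_left[OF b] that by (simp add: c_def)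
  have bc: "b (c x) = x" if "x \<in> D" for x
    using bij_betw_inv_into_right[OF b] that by (simp add: c_def)
  have bD: "b x \<in> D" if "x < card D" for x using b that by (auto simp: bij_betw_def)
  have cD: "c x < card D" if "x \<in> D" for x using c that by (auto simp: bij_betw_def)
  define m' where "m' = (\<lambda>x y z. c (m (b x) (b y) (b z)))"
  have "majority_on {..<card D} m'"
    using majority_onD[OF m] bD cD cb by (auto simp: majority_on_def m'_def)
  then obtain A where A: "A \<in> Obj C" "sz A = card D"
    "\<And>x y z. x < card D \<Longrightarrow> y < card D \<Longrightarrow> z < card D \<Longrightarrow> maj A x y z = m' x y z"
    using obj_exists by metis
  show thesis
    by (rule that[of A b c])
      (use A bD cD cb bc majority_onD[OF m] in \<open>auto simp: ternary_hom_def m'_def\<close>)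
qed

section \<open>Finite limits of finite majority algebras\<close>

lemma finitely_complete: "finitely_complete C"
  unfolding finitely_complete_def
proof (intro conjI allI impI)
  show "category C" by (rule category_axioms)
  fix J :: "(nat, nat) cat" and Fo Fa
  assume "category J \<and> finite (Obj J) \<and> finite (Arr J) \<and> is_functor J C Fo Fa"
  then have J: "category J" and fin: "finite (Obj J)" "finite (Arr J)" and F: "is_functor J C Fo Fa"
    by auto
  have Fo: "Fo j \<in> Obj C" if "j \<in> Obj J" for j using F that by (simp add: is_functor_def)
  have Fa: "Fa u \<in> hom C (Fo (Dom J u)) (Fo (Cod J u))" if "u \<in> Arr J" for u
    using F that by (simp add: is_functor_def)
  have dc: "Dom J u \<in> Obj J" "Cod J u \<in> Obj J" if "u \<in> Arr J" for u
    using category.dom_obj[OF J that] category.cod_obj[OF J that] by auto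
  \<comment> \<open>Compatible families form a subalgebra of the product because the maps of the
    diagram are homomorphisms. Extensional functions make \<open>D\<close> finite and make families
    equal once they agree on \<open>Obj J\<close>.\<close>
  define D where "D = {x \<in> (\<Pi>\<^sub>E j\<in>Obj J. {..<sz (Fo j)}).
    \<forall>u\<in>Arr J. fn (Fa u) (x (Dom J u)) = x (Cod J u)}"
  define m where "m = (\<lambda>x y z. \<lambda>j\<in>Obj J. maj (Fo j) (x j) (y j) (z j))"
  have xD: "x j < sz (Fo j)" if "x \<in> D" "j \<in> Obj J" for x j
    using that by (auto simp: D_def PiE_iff)
  have "finite D"
    unfolding D_def using finite_PiE[OF fin(1), of "\<lambda>j. {..<sz (Fo j)}"] by auto
  moreover have "majority_on D m"
    unfolding majority_on_def
  proof (intro conjI ballI)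
    fix x y z assume D: "x \<in> D" "y \<in> D" "z \<in> D"
    have "fn (Fa u) (m x y z (Dom J u)) = m x y z (Cod J u)" if u: "u \<in> Arr J" for u
      using dc[OF u] fn_maj[OF Fa[OF u] xD[OF D(1)] xD[OF D(2)] xD[OF D(3)]] D u
      by (simp add: m_def D_def)
    moreover have "m x y z \<in> (\<Pi>\<^sub>E j\<in>Obj J. {..<sz (Fo j)})"
      using maj_less[OF Fo] xD D by (auto simp: m_def)
    ultimately show "m x y z \<in> D" by (simp add: D_def)
  next
    fix x y assume xy: "x \<in> D" "y \<in> D"
    have "w = x" if "\<And>j. j \<in> Obj J \<Longrightarrow> w j = x j" "w \<in> extensional (Obj J)" for w
      using extensionalityI[OF that(2), of x] that(1) xy by (auto simp: D_def PiE_iff)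
    then show "m x x y = x" "m x y x = x" "m y x x = x"
      using majority_onD(2-4)[OF majority_obj[OF Fo]] xD xy by (auto simp: m_def)
  qed
  ultimately obtain A b c where A: "A \<in> Obj C" and b: "ternary_hom {..<sz A} (maj A) D m b"
    and c: "ternary_hom D m {..<sz A} (maj A) c"
    and cb: "\<And>x. x < sz A \<Longrightarrow> c (b x) = x" and bc: "\<And>x. x \<in> D \<Longrightarrow> b (c x) = x"
    using algebra_exists by metis
  have bD: "b x \<in> D" if "x < sz A" for x using ternary_homD(1)[OF b] that by simp
  have "\<exists>f \<in> hom C A (Fo j). \<forall>x<sz A. fn f x = b x j" if j: "j \<in> Obj J" for j
  proof (rule hom_exists[OF A Fo[OF j]])
    show "ternary_hom {..<sz A} (maj A) {..<sz (Fo j)} (maj (Fo j)) (\<lambda>x. b x j)"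
      using ternary_homD[OF b] xD j by (auto simp: ternary_hom_def m_def)
  qed
  then obtain p where p: "\<And>j. j \<in> Obj J \<Longrightarrow> p j \<in> hom C A (Fo j)"
    "\<And>j x. j \<in> Obj J \<Longrightarrow> x < sz A \<Longrightarrow> fn (p j) x = b x j"
    by metis
  have cone: "is_cone J C Fo Fa A p"
    unfolding is_cone_def
  proof (intro conjI ballI)
    fix u assume u: "u \<in> Arr J"
    show "Comp C (Fa u) (p (Dom J u)) = p (Cod J u)"
    proof (rule hom_eqI[OF comp_hom[OF p(1)[OF dc(1)[OF u]] Fa[OF u]] p(1)[OF dc(2)[OF u]]])
      fix x assume x: "x < sz A"
      show "fn (Comp C (Fa u) (p (Dom J u))) x = fn (p (Cod J u)) x"
        using fn_comp[OF p(1)[OF dc(1)[OF u]] Fa[OF u] x] p(2) dc[OF u] x bD[OF x] u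
        by (simp add: D_def)
    qed
  qed (use A p in auto)
  have "\<exists>!h. h \<in> hom C T A \<and> (\<forall>j\<in>Obj J. Comp C (p j) h = t j)" if t: "is_cone J C Fo Fa T t" for T t
  proof -
    have T: "T \<in> Obj C" and th: "\<And>j. j \<in> Obj J \<Longrightarrow> t j \<in> hom C T (Fo j)"
      and tc: "\<And>u. u \<in> Arr J \<Longrightarrow> Comp C (Fa u) (t (Dom J u)) = t (Cod J u)"
      using t by (auto simp: is_cone_def)
    define w where "w = (\<lambda>x. \<lambda>j\<in>Obj J. fn (t j) x)"
    have w: "w x \<in> D" if x: "x < sz T" for x
      using fn_less[OF th x] fn_comp[OF th[OF dc(1)] Fa x] tc dc by (auto simp: D_def w_def)
    have comp: "fn (p j) (fn h x) = fn (t j) x \<longleftrightarrow> b (fn h x) j = w x j"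
      if "h \<in> hom C T A" "x < sz T" "j \<in> Obj J" for h x j
      using that p(2) fn_less by (simp add: w_def)
    \<comment> \<open>Existence and uniqueness of the mediating arrow both follow from this
      equivalence, which prescribes its value at every element.\<close>
    have iff: "(\<forall>j\<in>Obj J. Comp C (p j) h = t j) \<longleftrightarrow> (\<forall>x<sz T. fn h x = c (w x))"
      if h: "h \<in> hom C T A" for h
    proof -
      have "(\<forall>j\<in>Obj J. Comp C (p j) h = t j) \<longleftrightarrow> (\<forall>j\<in>Obj J. \<forall>x<sz T. b (fn h x) j = w x j)"
        using hom_eq_iff[OF comp_hom[OF h p(1)] th] fn_comp[OF h p(1)] comp[OF h] by simp
      also have "\<dots> \<longleftrightarrow> (\<forall>x<sz T. b (fn h x) = w x)"
      proof -
        have "(\<forall>j\<in>Obj J. b (fn h x) j = w x j) \<longleftrightarrow> b (fn h x) = w x" if x: "x < sz T" for x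
          using bD[OF fn_less[OF h x]] w[OF x] extensionalityI[of "b (fn h x)" "Obj J" "w x"]
          by (auto simp: D_def PiE_iff)
        then show ?thesis by blast
      qed
      also have "\<dots> \<longleftrightarrow> (\<forall>x<sz T. fn h x = c (w x))"
        using cb bc w fn_less[OF h] by metis
      finally show ?thesis .
    qed
    obtain h where "h \<in> hom C T A" "\<And>x. x < sz T \<Longrightarrow> fn h x = c (w x)"
    proof (rule hom_exists'[OF T A, of "\<lambda>x. c (w x)"])
      fix x y z assume x: "x < sz T" and y: "y < sz T" and z: "z < sz T"
      show "c (w x) < sz A" using ternary_homD(1)[OF c w[OF x]] by simp
      have "w (maj T x y z) = m (w x) (w y) (w z)"
        using fn_maj[OF th x y z] by (auto simp: w_def m_def)
      then show "c (w (maj T x y z)) = maj A (c (w x)) (c (w y)) (c (w z))"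
        using ternary_homD(2)[OF c w[OF x] w[OF y] w[OF z]] by simp
    qed auto
    then show ?thesis using iff hom_eqI by (metis (no_types, lifting))
  qed
  with cone show "\<exists>L p. is_limit J C Fo Fa L p" unfolding is_limit_def by blast
qed

sublocale lex_category C
  by unfold_locales (rule finitely_complete)

section \<open>Elements as arrows from the one-element algebra\<close>

lemma one_exists:
  "\<exists>One \<in> Obj C. sz One = 1 \<and> (\<forall>A \<in> Obj C. \<forall>x<sz A. \<exists>f \<in> hom C One A. fn f 0 = x)"
proof -
  have "majority_on {..<1} (\<lambda>x y z. 0::nat)" by (auto simp: majority_on_def)
  then obtain One where One: "One \<in> Obj C" "sz One = 1" using obj_exists by blast
  have m0: "maj One 0 0 0 = 0" using maj_less[OF One(1), of 0 0 0] One(2) by simp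
  have "\<exists>f \<in> hom C One A. fn f 0 = x" if A: "A \<in> Obj C" and x: "x < sz A" for A x
  proof -
    \<comment> \<open>Idempotence makes constant maps homomorphisms, so every element is the value
      of an arrow from \<open>One\<close>.\<close>
    have "maj A x x x = x" using majority_on_idem[OF majority_obj[OF A]] x by simp
    then obtain f where "f \<in> hom C One A" "\<And>y. y < sz One \<Longrightarrow> fn f y = x"
      using hom_exists'[OF One(1) A, of "\<lambda>_. x"] x by auto
    then show ?thesis using One(2) by auto
  qed
  with One show ?thesis by blast
qed

lemma jointly_monic_injective:
  assumes jm: "jointly_monic C I X R r" and x: "x < sz R" "x' < sz R"
    and eq: "\<And>i. i \<in> I \<Longrightarrow> fn (r i) x = fn (r i) x'"
  shows "x = x'"
proof -
  have R: "R \<in> Obj C" using jm by (simp add: jointly_monic_def)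
  obtain One where One: "One \<in> Obj C" "sz One = 1"
    "\<And>A x. A \<in> Obj C \<Longrightarrow> x < sz A \<Longrightarrow> \<exists>f \<in> hom C One A. fn f 0 = x"
    using one_exists by blast
  obtain f g where f: "f \<in> hom C One R" "fn f 0 = x" and g: "g \<in> hom C One R" "fn g 0 = x'"
    using One(3)[OF R] x by metis
  have "f = g"
  proof (rule jointly_monicD[OF jm f(1) g(1)])
    fix i assume i: "i \<in> I"
    note ri = jointly_monic_hom[OF jm i]
    show "Comp C (r i) f = Comp C (r i) g"
      by (rule hom_eqI[OF comp_hom[OF f(1) ri] comp_hom[OF g(1) ri]])
        (use fn_comp[OF f(1) ri] fn_comp[OF g(1) ri] f(2) g(2) eq[OF i] One(2) in simp)
  qed
  then show ?thesis using f g by simp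
qed

text \<open>Regarded as points, \<open>x\<close> and \<open>y\<close> complete the cospan to a
  commutative square; \<open>k\<close> is the point it induces.\<close>

lemma pullback_point:
  assumes pb: "is_pullback C f g p q" and x: "x < sz (Dom C f)" and y: "y < sz (Dom C g)"
    and eq: "fn f x = fn g y"
  obtains k where "k < sz (Dom C p)" "fn p k = x" "fn q k = y"
proof -
  have f: "f \<in> hom C (Dom C f) (Cod C f)" and g: "g \<in> hom C (Dom C g) (Cod C f)"
    and p: "p \<in> hom C (Dom C p) (Dom C f)" and q: "q \<in> hom C (Dom C p) (Dom C g)"
    using pb by (auto simp: is_pullback_def hom_def)
  obtain One where One: "One \<in> Obj C" "sz One = 1"
    "\<And>A x. A \<in> Obj C \<Longrightarrow> x < sz A \<Longrightarrow> \<exists>f \<in> hom C One A. fn f 0 = x"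
    using one_exists by blast
  obtain a b where a: "a \<in> hom C One (Dom C f)" "fn a 0 = x" and b: "b \<in> hom C One (Dom C g)" "fn b 0 = y"
    using One(3) hom_obj(1)[OF f] hom_obj(1)[OF g] x y by metis
  have "Comp C f a = Comp C g b"
    by (rule hom_eqI[OF comp_hom[OF a(1) f] comp_hom[OF b(1) g]])
      (use fn_comp[OF a(1) f] fn_comp[OF b(1) g] a(2) b(2) eq One(2) in simp)
  then obtain h where h: "h \<in> hom C One (Dom C p)" "Comp C p h = a" "Comp C q h = b"
    using pb a(1) b(1) unfolding is_pullback_def by blast
  show thesis
    by (rule that[of "fn h 0"])
      (use fn_less[OF h(1)] fn_comp[OF h(1) p] fn_comp[OF h(1) q] h(2,3) a(2) b(2) One(2) in auto)
qed

section \<open>Images, quotients and regularity\<close>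

lemma image_algebra:
  assumes f: "f \<in> hom C A B"
  obtains Q e m where "e \<in> hom C A Q" "m \<in> hom C Q B" "Comp C m e = f"
    "fn e ` {..<sz A} = {..<sz Q}" "inj_on (fn m) {..<sz Q}"
proof -
  note AB = hom_obj[OF f]
  let ?D = "fn f ` {..<sz A}"
  have sub: "x \<in> ?D \<Longrightarrow> x < sz B" for x using fn_less[OF f] by auto
  have "majority_on ?D (maj B)"
    unfolding majority_on_def
  proof (intro conjI ballI)
    fix x y z assume "x \<in> ?D" "y \<in> ?D" "z \<in> ?D"
    then obtain x' y' z' where "x' < sz A" "y' < sz A" "z' < sz A" "x = fn f x'" "y = fn f y'" "z = fn f z'"
      by auto
    then have "maj B x y z = fn f (maj A x' y' z')" "maj A x' y' z' < sz A"
      using fn_maj[OF f] maj_less[OF AB(1)] by auto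
    then show "maj B x y z \<in> ?D" by auto
  qed (use majority_onD(2-4)[OF majority_obj[OF AB(2)]] sub in auto)
  then obtain Q b c where Q: "Q \<in> Obj C" and b: "ternary_hom {..<sz Q} (maj Q) ?D (maj B) b"
    and c: "ternary_hom ?D (maj B) {..<sz Q} (maj Q) c"
    and cb: "\<And>x. x < sz Q \<Longrightarrow> c (b x) = x" and bc: "\<And>x. x \<in> ?D \<Longrightarrow> b (c x) = x"
    using algebra_exists[of ?D "maj B"] by (metis finite_imageI finite_lessThan)
  obtain e where e: "e \<in> hom C A Q" "\<And>x. x < sz A \<Longrightarrow> fn e x = c (fn f x)"
  proof (rule hom_exists'[OF AB(1) Q, of "\<lambda>x. c (fn f x)"])
    fix x y z assume x: "x < sz A" and y: "y < sz A" and z: "z < sz A"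
    show "c (fn f x) < sz Q" using ternary_homD(1)[OF c] x by auto
    show "c (fn f (maj A x y z)) = maj Q (c (fn f x)) (c (fn f y)) (c (fn f z))"
      using ternary_homD(2)[OF c] fn_maj[OF f x y z] x y z by auto
  qed auto
  obtain m where m: "m \<in> hom C Q B" "\<And>x. x < sz Q \<Longrightarrow> fn m x = b x"
  proof (rule hom_exists'[OF Q AB(2), of b])
    fix x y z assume x: "x < sz Q" and y: "y < sz Q" and z: "z < sz Q"
    show "b x < sz B" using ternary_homD(1)[OF b] x sub by blast
    show "b (maj Q x y z) = maj B (b x) (b y) (b z)" using ternary_homD(2)[OF b] x y z by auto
  qed auto
  show thesis
  proof (rule that[OF e(1) m(1)])
    show "Comp C m e = f"
      by (rule hom_eqI[OF comp_hom[OF e(1) m(1)] f])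
        (use fn_comp[OF e(1) m(1)] e(2) m(2) bc fn_less[OF e(1)] in auto)
    show "inj_on (fn m) {..<sz Q}" using m(2) cb by (metis inj_onI lessThan_iff)
    have "y \<in> fn e ` {..<sz A}" if y: "y < sz Q" for y
    proof -
      obtain x where "x < sz A" "b y = fn f x" using ternary_homD(1)[OF b] y by blast
      then show ?thesis using e(2)[of x] cb[OF y] by (metis image_eqI lessThan_iff)
    qed
    then show "fn e ` {..<sz A} = {..<sz Q}" using fn_less[OF e(1)] by auto
  qed
qed

text \<open>The homomorphism theorem. Keeping \<open>e\<close> apart from \<open>f\<close> serves
  two uses: with \<open>e\<close> the surjective part of \<open>f\<close> it provides coequalisers
  of kernel pairs, and with \<open>e = f\<close> it shows that surjections are regular
  epimorphisms.\<close>

lemma kernel_pair_coequaliser_surjective: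
  assumes kp: "is_kernel_pair C f p q" and e: "e \<in> hom C (Dom C f) Q"
    and surj: "fn e ` {..<sz (Dom C f)} = {..<sz Q}"
    and ker: "\<And>x y. x < sz (Dom C f) \<Longrightarrow> y < sz (Dom C f) \<Longrightarrow> fn e x = fn e y \<longleftrightarrow> fn f x = fn f y"
  shows "is_coequaliser C p q e"
proof -
  define A where "A = Dom C f"
  define K where "K = Dom C p"
  have pb: "is_pullback C f f p q" using kp by (simp add: is_kernel_pair_def)
  have f: "f \<in> hom C A (Cod C f)" and p: "p \<in> hom C K A" and q: "q \<in> hom C K A"
    and fpq: "Comp C f p = Comp C f q"
    using pb by (auto simp: is_pullback_def hom_def A_def K_def)
  note e = e[folded A_def] and surj = surj[folded A_def] and ker = ker[folded A_def]
  note A = hom_obj(1)[OF e] and Q = hom_obj(2)[OF e]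
  have epq: "Comp C e p = Comp C e q"
  proof (rule hom_eqI[OF comp_hom[OF p e] comp_hom[OF q e]])
    fix x assume x: "x < sz K"
    have "fn f (fn p x) = fn f (fn q x)" using fn_comp[OF p f x] fn_comp[OF q f x] fpq by simp
    then show "fn (Comp C e p) x = fn (Comp C e q) x"
      using fn_comp[OF p e x] fn_comp[OF q e x] ker fn_less[OF p x] fn_less[OF q x] by simp
  qed
  have "\<exists>!u. u \<in> hom C Q T \<and> Comp C u e = h" if h: "h \<in> hom C A T" and hpq: "Comp C h p = Comp C h q" for T h
  proof -
    note T = hom_obj(2)[OF h]
    have hker: "fn h x = fn h y" if xy: "x < sz A" "y < sz A" "fn e x = fn e y" for x y
    proof -
      have "fn f x = fn f y" using ker xy by blast
      then obtain k where k: "k < sz K" "fn p k = x" "fn q k = y"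
        using pullback_point[OF pb, of x y] xy by (auto simp: A_def K_def)
      show ?thesis using fn_comp[OF p h k(1)] fn_comp[OF q h k(1)] k(2,3) hpq by simp
    qed
    \<comment> \<open>A section of \<open>e\<close> as a map, not as a homomorphism; by
      \<open>hker\<close> the values of \<open>h\<close> do not depend on the chosen
      preimages.\<close>
    define s where "s = inv_into {..<sz A} (fn e)"
    have s: "s y < sz A" "fn e (s y) = y" if "y < sz Q" for y
      using inv_into_into[of y "fn e" "{..<sz A}"] f_inv_into_f[of y "fn e" "{..<sz A}"] that surj
      by (auto simp: s_def)
    obtain u where u: "u \<in> hom C Q T" "\<And>y. y < sz Q \<Longrightarrow> fn u y = fn h (s y)"
    proof (rule hom_exists'[OF Q T, of "\<lambda>y. fn h (s y)"])
      fix x y z assume x: "x < sz Q" and y: "y < sz Q" and z: "z < sz Q"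
      show "fn h (s x) < sz T" using fn_less[OF h s(1)[OF x]] .
      have "fn e (s (maj Q x y z)) = fn e (maj A (s x) (s y) (s z))"
        using fn_maj[OF e s(1)[OF x] s(1)[OF y] s(1)[OF z]] s(2) maj_less[OF Q x y z] x y z by simp
      then have "fn h (s (maj Q x y z)) = fn h (maj A (s x) (s y) (s z))"
        using hker[OF s(1)[OF maj_less[OF Q x y z]] maj_less[OF A s(1)[OF x] s(1)[OF y] s(1)[OF z]]]
        by blast
      then show "fn h (s (maj Q x y z)) = maj T (fn h (s x)) (fn h (s y)) (fn h (s z))"
        using fn_maj[OF h s(1)[OF x] s(1)[OF y] s(1)[OF z]] by simp
    qed auto
    have "Comp C u e = h"
    proof (rule hom_eqI[OF comp_hom[OF e u(1)] h])
      fix x assume x: "x < sz A"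
      show "fn (Comp C u e) x = fn h x"
        using fn_comp[OF e u(1) x] u(2) fn_less[OF e x] hker[OF s(1) x] s(2) x by simp
    qed
    moreover have "v = u" if v: "v \<in> hom C Q T" "Comp C v e = h" for v
    proof (rule hom_eqI[OF v(1) u(1)])
      fix y assume y: "y < sz Q"
      show "fn v y = fn u y"
        using fn_comp[OF e v(1) s(1)[OF y]] v(2) s(2)[OF y] u(2)[OF y] by simp
    qed
    ultimately show ?thesis using u(1) by blast
  qed
  then show ?thesis
    using epq homD[OF p] homD[OF q] homD[OF e] by (auto simp: is_coequaliser_def)
qed

lemma surjective_regular_epi:
  assumes f: "f \<in> hom C A B" and surj: "fn f ` {..<sz A} = {..<sz B}"
  shows "regular_epi C f"
proof -
  obtain K p q where pb: "is_pullback C f f p q" using pullback_exists[OF f f] by blast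
  have "is_coequaliser C p q f"
    by (rule kernel_pair_coequaliser_surjective[of f p q f B])
      (use pb f surj homD[OF f] in \<open>auto simp: is_kernel_pair_def\<close>)
  then show ?thesis by (auto simp: regular_epi_def)
qed

text \<open>Since \<open>m\<close> is injective, \<open>e\<close> coequalises the same pair as
  \<open>q\<close> and factors as \<open>Comp C u q\<close>. Cancelling \<open>q\<close> gives that
  \<open>u\<close> is a section of \<open>m\<close>, so \<open>m\<close> is onto as well as
  \<open>e\<close>.\<close>

lemma regular_epi_surjective:
  assumes re: "regular_epi C q" and q: "q \<in> hom C A B"
  shows "fn q ` {..<sz A} = {..<sz B}"
proof -
  obtain f g where co: "is_coequaliser C f g q" using re by (auto simp: regular_epi_def)
  define K where "K = Dom C f"
  have f: "f \<in> hom C K A" and g: "g \<in> hom C K A" and qfg: "Comp C q f = Comp C q g"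
    and cods: "Cod C f = A" "Cod C q = B"
    using co q by (auto simp: is_coequaliser_def hom_def K_def)
  obtain Q e m where e: "e \<in> hom C A Q" and m: "m \<in> hom C Q B" and me: "Comp C m e = q"
    and surj: "fn e ` {..<sz A} = {..<sz Q}" and inj: "inj_on (fn m) {..<sz Q}"
    using image_algebra[OF q] .
  have "Comp C e f = Comp C e g"
  proof (rule hom_eqI[OF comp_hom[OF f e] comp_hom[OF g e]])
    fix x assume x: "x < sz K"
    have 1: "fn m (fn e (fn k x)) = fn (Comp C q k) x" if k: "k \<in> hom C K A" for k
      using fn_comp[OF k q x] fn_comp[OF e m fn_less[OF k x]] me by simp
    have "fn e (fn f x) = fn e (fn g x)"
      using 1[OF f] 1[OF g] qfg inj fn_less[OF e fn_less[OF f x]] fn_less[OF e fn_less[OF g x]]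
      by (auto simp: inj_on_def)
    then show "fn (Comp C e f) x = fn (Comp C e g) x"
      using fn_comp[OF f e x] fn_comp[OF g e x] by simp
  qed
  then obtain u where u: "u \<in> hom C B Q" "Comp C u q = e"
    using co e cods unfolding is_coequaliser_def by blast
  have B: "B \<in> Obj C" using hom_obj(2)[OF q] .
  have "Comp C m u = Ident C B"
    by (rule regular_epi_cancel[OF re q comp_hom[OF u(1) m] ident_hom[OF B]])
      (use comp_assoc[OF q u(1) m] u(2) me comp_ident_left[OF q] in simp)
  have "y \<in> fn q ` {..<sz A}" if y: "y < sz B" for y
  proof -
    have "fn m (fn u y) = y"
      using fn_comp[OF u(1) m y] \<open>Comp C m u = Ident C B\<close> fn_ident[OF B y] by simp
    moreover obtain x where "x < sz A" "fn e x = fn u y"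
      using surj fn_less[OF u(1) y] by (metis (no_types, lifting) imageE lessThan_iff)
    ultimately show ?thesis using fn_comp[OF e m, of x] me by (metis image_eqI lessThan_iff)
  qed
  then show ?thesis using fn_less[OF q] by auto
qed

text \<open>Once regular epimorphisms are known to be the surjections, their stability is checked on
  elements of the pullback.\<close>

lemma regular_category: "regular_category C"
  unfolding regular_category_def
proof (intro conjI allI impI)
  show "finitely_complete C" by (rule finitely_complete)
next
  fix f p q assume kp: "is_kernel_pair C f p q"
  then have f: "f \<in> hom C (Dom C f) (Cod C f)" by (auto simp: is_kernel_pair_def is_pullback_def hom_def)
  obtain Q e m where e: "e \<in> hom C (Dom C f) Q" and m: "m \<in> hom C Q (Cod C f)"
    and me: "Comp C m e = f"
    and surj: "fn e ` {..<sz (Dom C f)} = {..<sz Q}" and inj: "inj_on (fn m) {..<sz Q}"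
    using image_algebra[OF f] .
  have "is_coequaliser C p q e"
  proof (rule kernel_pair_coequaliser_surjective[OF kp e surj])
    fix x y assume "x < sz (Dom C f)" "y < sz (Dom C f)"
    then show "fn e x = fn e y \<longleftrightarrow> fn f x = fn f y"
      using fn_comp[OF e m] me fn_less[OF e] inj by (metis inj_onD lessThan_iff)
  qed
  then show "\<exists>e. is_coequaliser C p q e" ..
next
  fix f g p q assume A: "is_pullback C f g p q \<and> regular_epi C f"
  then have f: "f \<in> hom C (Dom C f) (Cod C f)" and g: "g \<in> hom C (Dom C g) (Cod C f)"
    and q: "q \<in> hom C (Dom C p) (Dom C g)"
    by (auto simp: is_pullback_def hom_def)
  have "y \<in> fn q ` {..<sz (Dom C p)}" if y: "y < sz (Dom C g)" for y
  proof -
    have "fn g y \<in> fn f ` {..<sz (Dom C f)}"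
      using regular_epi_surjective[OF _ f] A fn_less[OF g y] by auto
    then obtain x where "x < sz (Dom C f)" "fn f x = fn g y" by auto
    then obtain k where "k < sz (Dom C p)" "fn q k = y"
      using pullback_point[of f g p q x y] A y by metis
    then show ?thesis by blast
  qed
  then have "fn q ` {..<sz (Dom C p)} = {..<sz (Dom C g)}" using fn_less[OF q] by auto
  then show "regular_epi C q" using surjective_regular_epi[OF q] by blast
qed

section \<open>\<open>Maj\<close> holds and \<open>Mal\<close> fails for majority algebras\<close>

lemma closed_families_Maj: "closed_families C Maj"
  unfolding closed_families_Maj_iff
proof (intro allI impI, elim conjE)
  fix X S R r f g
  assume S: "S \<in> Obj C" and jm: "jointly_monic C {..<3} X R r"
    and fg: "\<forall>i<3. f i \<in> hom C S (X i) \<and> g i \<in> hom C S (X i)"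
    and left: "\<forall>j<3. \<exists>h \<in> hom C S R. \<forall>i<3. Comp C (r i) h = (if i = 2 - j then g i else f i)"
  have R: "R \<in> Obj C" using jm by (simp add: jointly_monic_def)
  have r: "r i \<in> hom C R (X i)" if "i < 3" for i using jointly_monic_hom[OF jm] that by simp
  obtain H where H: "\<And>j. j < 3 \<Longrightarrow> H j \<in> hom C S R"
    "\<And>j i. j < 3 \<Longrightarrow> i < 3 \<Longrightarrow> Comp C (r i) (H j) = (if i = 2 - j then g i else f i)"
    using left by metis
  \<comment> \<open>The majority operation of \<open>R\<close> applied to the three witnesses: in
    each coordinate at least two of them have the value of \<open>f i\<close>.\<close>
  define w where "w = (\<lambda>x. maj R (fn (H 0) x) (fn (H 1) x) (fn (H 2) x))"
  have Hx: "fn (H 0) x < sz R" "fn (H 1) x < sz R" "fn (H 2) x < sz R" if "x < sz S" for x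
    using fn_less[OF H(1) that] by auto
  have w: "w x < sz R" if "x < sz S" for x
    unfolding w_def using maj_less[OF R] Hx[OF that] by blast
  have rw: "fn (r i) (w x) = fn (f i) x" if i: "i < 3" and x: "x < sz S" for i x
  proof -
    have rH: "fn (r i) (fn (H j) x) = (if i = 2 - j then fn (g i) x else fn (f i) x)" if "j < 3" for j
      using fn_comp[OF H(1)[OF that] r[OF i] x] H(2)[OF that i] by (simp split: if_splits)
    have lt: "fn (f i) x < sz (X i)" "fn (g i) x < sz (X i)" using fg fn_less i x by blast+
    have "fn (r i) (w x) = maj (X i) (fn (r i) (fn (H 0) x)) (fn (r i) (fn (H 1) x)) (fn (r i) (fn (H 2) x))"
      unfolding w_def using fn_maj[OF r[OF i]] Hx[OF x] by blast
    also have "\<dots> = fn (f i) x"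
      using i majority_onD(2-4)[OF majority_obj[OF hom_obj(2)[OF r[OF i]]]] lt
      by (auto simp: rH less_3_iff)
    finally show ?thesis .
  qed
  \<comment> \<open>A pointwise majority of homomorphisms need not be a homomorphism. This one is,
    because its coordinates \<open>f i\<close> are and the \<open>r i\<close> are jointly
    injective.\<close>
  obtain h where h: "h \<in> hom C S R" "\<And>x. x < sz S \<Longrightarrow> fn h x = w x"
  proof (rule hom_exists'[OF S R, of w])
    fix x y z assume x: "x < sz S" and y: "y < sz S" and z: "z < sz S"
    note xyz = maj_less[OF S x y z]
    show "w x < sz R" using w[OF x] .
    show "w (maj S x y z) = maj R (w x) (w y) (w z)"
    proof (rule jointly_monic_injective[OF jm w[OF xyz] maj_less[OF R w[OF x] w[OF y] w[OF z]]])
      fix i :: nat assume "i \<in> {..<3}"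
      then have i: "i < 3" by simp
      have "fn (r i) (w (maj S x y z)) = maj (X i) (fn (f i) x) (fn (f i) y) (fn (f i) z)"
        using rw[OF i xyz] fn_maj[of "f i" S "X i" x y z] fg i x y z by simp
      also have "\<dots> = fn (r i) (maj R (w x) (w y) (w z))"
        using fn_maj[OF r[OF i] w[OF x] w[OF y] w[OF z]] rw[OF i] x y z by simp
      finally show "fn (r i) (w (maj S x y z)) = fn (r i) (maj R (w x) (w y) (w z))" .
    qed
  qed auto
  have "Comp C (r i) h = f i" if i: "i < 3" for i
  proof (rule hom_eqI[OF comp_hom[OF h(1) r[OF i]]])
    show "f i \<in> hom C S (X i)" using fg i by blast
    show "fn (Comp C (r i) h) x = fn (f i) x" if "x < sz S" for x
      using fn_comp[OF h(1) r[OF i] that] h(2)[OF that] rw[OF i that] by simp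
  qed
  with h(1) show "\<exists>h \<in> hom C S R. \<forall>i<3. Comp C (r i) h = f i" by blast
qed

text \<open>The order of the two-element algebra is a subalgebra of its square, but as a relation it
  violates the Mal'tsev property.\<close>

lemma not_closed_families_Mal: "\<not> closed_families C Mal"
proof
  assume Mal: "closed_families C Mal"
  \<comment> \<open>On two elements the majority operation is forced: if \<open>y\<close> and
    \<open>z\<close> differ, then \<open>x\<close> equals one of them. It is the median, which is
    monotone, so the order \<open>D\<close> is closed under it.\<close>
  define m where "m = (\<lambda>x y z. if y = z then y else x :: nat)"
  have "majority_on {..<2} m" by (auto simp: majority_on_def m_def)
  then obtain A where A: "A \<in> Obj C" "sz A = 2"
    "\<And>x y z. x < 2 \<Longrightarrow> y < 2 \<Longrightarrow> z < 2 \<Longrightarrow> maj A x y z = m x y z"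
    using obj_exists by metis
  define D :: "(nat \<times> nat) set" where "D = {(0, 0), (0, 1), (1, 1)}"
  define m2 where "m2 = (\<lambda>x y z. (m (fst x) (fst y) (fst z), m (snd x) (snd y) (snd z)))"
  have "majority_on D m2" by (auto simp: majority_on_def D_def m2_def m_def)
  moreover have "finite D" by (simp add: D_def)
  ultimately obtain R b c where R: "R \<in> Obj C" and b: "ternary_hom {..<sz R} (maj R) D m2 b"
    and c: "ternary_hom D m2 {..<sz R} (maj R) c"
    and cb: "\<And>x. x < sz R \<Longrightarrow> c (b x) = x" and bc: "\<And>x. x \<in> D \<Longrightarrow> b (c x) = x"
    using algebra_exists by metis
  have bD: "b x \<in> D" if "x < sz R" for x using ternary_homD(1)[OF b] that by simp
  have b2: "fst (b x) < 2" "snd (b x) < 2" if "x < sz R" for x using bD[OF that] by (auto simp: D_def)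
  have bm: "b (maj R x y z) = m2 (b x) (b y) (b z)" if "x < sz R" "y < sz R" "z < sz R" for x y z
    using ternary_homD(2)[OF b] that by simp
  obtain r0 where r0: "r0 \<in> hom C R A" "\<And>x. x < sz R \<Longrightarrow> fn r0 x = fst (b x)"
    by (rule hom_exists'[OF R A(1), of "\<lambda>x. fst (b x)"]) (use A b2 bm in \<open>auto simp: m2_def\<close>)
  obtain r1 where r1: "r1 \<in> hom C R A" "\<And>x. x < sz R \<Longrightarrow> fn r1 x = snd (b x)"
    by (rule hom_exists'[OF R A(1), of "\<lambda>x. snd (b x)"]) (use A b2 bm in \<open>auto simp: m2_def\<close>)
  define r where "r = (\<lambda>i::nat. if i = 0 then r0 else r1)"
  have jm: "jointly_monic C {..<2} (\<lambda>_. A) R r"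
    unfolding jointly_monic_def
  proof (intro conjI allI ballI impI)
    fix T f g assume f: "f \<in> hom C T R" and g: "g \<in> hom C T R"
      and eq: "\<forall>i\<in>{..<2}. Comp C (r i) f = Comp C (r i) g"
    show "f = g"
    proof (rule hom_eqI[OF f g])
      fix x assume x: "x < sz T"
      have "Comp C r0 f = Comp C r0 g" "Comp C r1 f = Comp C r1 g"
        using eq[rule_format, of 0] eq[rule_format, of 1] by (auto simp: r_def)
      then have "b (fn f x) = b (fn g x)"
        using fn_comp[OF f r0(1) x] fn_comp[OF g r0(1) x] fn_comp[OF f r1(1) x] fn_comp[OF g r1(1) x]
          r0(2) r1(2) fn_less[OF f x] fn_less[OF g x] by (simp add: prod_eq_iff)
      then show "fn f x = fn g x" using cb fn_less[OF f x] fn_less[OF g x] by metis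
    qed
  qed (use R r0 r1 in \<open>auto simp: r_def\<close>)
  obtain One where One: "One \<in> Obj C" "sz One = 1"
    "\<And>A x. A \<in> Obj C \<Longrightarrow> x < sz A \<Longrightarrow> \<exists>f \<in> hom C One A. fn f 0 = x"
    using one_exists by blast
  obtain a0 a1 where a0: "a0 \<in> hom C One A" "fn a0 0 = 0" and a1: "a1 \<in> hom C One A" "fn a1 0 = 1"
    using One(3)[OF A(1), of 0] One(3)[OF A(1), of 1] A(2) by auto
  have pt: "\<exists>h \<in> hom C One R. Comp C (r 0) h = x \<and> Comp C (r 1) h = y"
    if x: "x \<in> hom C One A" and y: "y \<in> hom C One A" and D: "(fn x 0, fn y 0) \<in> D" for x y
  proof -
    have "c (fn x 0, fn y 0) < sz R" using ternary_homD(1)[OF c D] by simp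
    then obtain h where h: "h \<in> hom C One R" "fn h 0 = c (fn x 0, fn y 0)" using One(3)[OF R] by blast
    have hR: "fn h 0 < sz R" using fn_less[OF h(1)] One(2) by simp
    have "Comp C r0 h = x"
      by (rule hom_eqI[OF comp_hom[OF h(1) r0(1)] x])
        (use fn_comp[OF h(1) r0(1)] r0(2)[OF hR] h(2) bc[OF D] One(2) in simp)
    moreover have "Comp C r1 h = y"
      by (rule hom_eqI[OF comp_hom[OF h(1) r1(1)] y])
        (use fn_comp[OF h(1) r1(1)] r1(2)[OF hR] h(2) bc[OF D] One(2) in simp)
    ultimately show ?thesis using h(1) by (auto simp: r_def)
  qed
  \<comment> \<open>The left columns are the pairs \<open>(1, 1)\<close>, \<open>(0, 1)\<close>,
    \<open>(0, 0)\<close> of the order; the right column is \<open>(1, 0)\<close>, the only pair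
    outside it.\<close>
  have "\<exists>h \<in> hom C One R. Comp C (r 0) h = a1 \<and> Comp C (r 1) h = a0"
    by (rule Mal[unfolded closed_families_Mal_iff, rule_format, of One "\<lambda>_. A" R r a1 a0 a0 a1])
      (use One(1) jm A(1) a0 a1 pt in \<open>auto simp: D_def\<close>)
  then obtain h where h: "h \<in> hom C One R" "Comp C r0 h = a1" "Comp C r1 h = a0"
    by (auto simp: r_def)
  have hR: "fn h 0 < sz R" using fn_less[OF h(1)] One(2) by simp
  have "b (fn h 0) = (1, 0)"
    using fn_comp[OF h(1) r0(1), of 0] fn_comp[OF h(1) r1(1), of 0] h(2,3) a0(2) a1(2) One(2)
      r0(2)[OF hR] r1(2)[OF hR] by (simp add: prod_eq_iff)
  then show False using bD[OF hR] by (auto simp: D_def)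
qed

end

section \<open>Coding finite majority algebras in infinite types\<close>

text \<open>An algebra on \<open>{..<d}\<close> is coded by \<open>d\<close> and the table of its operation, an arrow by its
  domain, its codomain and the list of its values.  The codes form countable types.\<close>

type_synonym algebra_code = "nat \<times> nat list list list"
type_synonym arrow_code = "algebra_code \<times> algebra_code \<times> nat list"

definition table_op :: "algebra_code \<Rightarrow> nat \<Rightarrow> nat \<Rightarrow> nat \<Rightarrow> nat" where
  "table_op A x y z = snd A ! x ! y ! z"

text \<open>Tables are constrained only on the carrier, so one algebra has several codes. They
  become isomorphic but distinct objects, which is harmless.\<close>

definition algebra_codes :: "algebra_code set" where
  "algebra_codes = {A. majority_on {..<fst A} (table_op A)}"

text \<open>Fixing the length leaves exactly one list for each homomorphism, so that arrows with the
  same values are equal.\<close>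

definition arrow_codes :: "algebra_code \<Rightarrow> algebra_code \<Rightarrow> nat list set" where
  "arrow_codes A B = {l. length l = fst A \<and>
     ternary_hom {..<fst A} (table_op A) {..<fst B} (table_op B) (nth l)}"

text \<open>Domain and codomain are part of the code of an arrow, as one list of values can be a
  homomorphism between different algebras.\<close>

definition majority_cat :: "(algebra_code \<Rightarrow> 'o) \<Rightarrow> (arrow_code \<Rightarrow> 'a) \<Rightarrow> ('o, 'a) cat" where
  "majority_cat \<phi> \<psi> = \<lparr>Obj = \<phi> ` algebra_codes,
     Arr = {\<psi> (A, B, l) | A B l. A \<in> algebra_codes \<and> B \<in> algebra_codes \<and> l \<in> arrow_codes A B},
     Dom = (\<lambda>f. \<phi> (fst (the_inv \<psi> f))),
     Cod = (\<lambda>f. \<phi> (fst (snd (the_inv \<psi> f)))),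
     Ident = (\<lambda>A. \<psi> (the_inv \<phi> A, the_inv \<phi> A, [0..<fst (the_inv \<phi> A)])),
     Comp = (\<lambda>g f. \<psi> (fst (the_inv \<psi> f), fst (snd (the_inv \<psi> g)),
       map (nth (snd (snd (the_inv \<psi> g)))) (snd (snd (the_inv \<psi> f)))))\<rparr>"

lemma id_arrow_code: "[0..<fst A] \<in> arrow_codes A A" if "A \<in> algebra_codes"
  using that majority_onD(1)[of "{..<fst A}" "table_op A"]
  by (auto simp: arrow_codes_def ternary_hom_def algebra_codes_def)

lemma comp_arrow_code:
  assumes "A \<in> algebra_codes" "l \<in> arrow_codes A B" "l' \<in> arrow_codes B D"
  shows "map (nth l') l \<in> arrow_codes A D"
proof -
  have m: "table_op A x y z < fst A" if "x < fst A" "y < fst A" "z < fst A" for x y z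
    using majority_onD(1)[of "{..<fst A}" "table_op A"] assms(1) that by (auto simp: algebra_codes_def)
  show ?thesis
    using assms(2,3) m by (auto simp: arrow_codes_def ternary_hom_def)
qed

lemma majority_algebras_majority_cat:
  fixes \<phi> :: "algebra_code \<Rightarrow> 'o" and \<psi> :: "arrow_code \<Rightarrow> 'a"
  assumes "inj \<phi>" "inj \<psi>"
  shows "majority_algebras (majority_cat \<phi> \<psi>) (\<lambda>A. fst (the_inv \<phi> A)) (\<lambda>A. table_op (the_inv \<phi> A))
    (\<lambda>f. nth (snd (snd (the_inv \<psi> f))))"
proof -
  let ?C = "majority_cat \<phi> \<psi>"
  have inv [simp]: "the_inv \<phi> (\<phi> A) = A" "the_inv \<psi> (\<psi> f) = f" for A f
    using assms by (auto simp: the_inv_f_f)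
  have inj [simp]: "\<phi> A = \<phi> B \<longleftrightarrow> A = B" "\<psi> f = \<psi> g \<longleftrightarrow> f = g" for A B f g
    using assms by (auto simp: inj_eq)
  have obj: "X \<in> Obj ?C \<longleftrightarrow> (\<exists>A \<in> algebra_codes. X = \<phi> A)" for X
    by (auto simp: majority_cat_def)
  have hom: "f \<in> hom ?C X Y \<longleftrightarrow> (\<exists>A \<in> algebra_codes. \<exists>B \<in> algebra_codes. \<exists>l \<in> arrow_codes A B.
      X = \<phi> A \<and> Y = \<phi> B \<and> f = \<psi> (A, B, l))" for f X Y
    by (auto simp: majority_cat_def hom_def)
  have ident: "Ident ?C (\<phi> A) = \<psi> (A, A, [0..<fst A])" for A
    by (simp add: majority_cat_def)
  have comp: "Comp ?C (\<psi> (B', D, l')) (\<psi> (A, B, l)) = \<psi> (A, D, map (nth l') l)" for A B B' D l l'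
    by (simp add: majority_cat_def)
  have len: "length l = fst A" "x < fst A \<Longrightarrow> l ! x < fst B" "y \<in> set l \<Longrightarrow> y < fst B"
    if "l \<in> arrow_codes A B" for l A B x y
    using that by (auto simp: arrow_codes_def ternary_hom_def in_set_conv_nth)
  show ?thesis
  proof unfold_locales
    fix f assume "f \<in> Arr ?C"
    then show "Dom ?C f \<in> Obj ?C" "Cod ?C f \<in> Obj ?C" by (auto simp: majority_cat_def)
  next
    fix A assume "A \<in> Obj ?C"
    then show "Ident ?C A \<in> hom ?C A A" unfolding obj hom using ident id_arrow_code by metis
  next
    fix f A B g D assume "f \<in> hom ?C A B" "g \<in> hom ?C B D"
    then show "Comp ?C g f \<in> hom ?C A D" by (auto simp: hom comp comp_arrow_code)
  next
    fix f A B assume "f \<in> hom ?C A B"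
    then show "Comp ?C f (Ident ?C A) = f" "Comp ?C (Ident ?C B) f = f"
      using len(2)[where A = "(_, _)" and B = "(_, _)"]
      by (auto simp: hom comp ident len(1) intro!: nth_equalityI)
  next
    fix f A B g D h E assume "f \<in> hom ?C A B" "g \<in> hom ?C B D" "h \<in> hom ?C D E"
    then show "Comp ?C (Comp ?C h g) f = Comp ?C h (Comp ?C g f)"
      using len(3)[where A = "(_, _)" and B = "(_, _)"]
      by (fastforce simp: hom comp len(1))
  next
    fix A assume "A \<in> Obj ?C"
    then show "majority_on {..<fst (the_inv \<phi> A)} (table_op (the_inv \<phi> A))"
      by (auto simp: obj algebra_codes_def)
  next
    fix f A B assume "f \<in> hom ?C A B"
    then show "ternary_hom {..<fst (the_inv \<phi> A)} (table_op (the_inv \<phi> A)) {..<fst (the_inv \<phi> B)}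
        (table_op (the_inv \<phi> B)) (nth (snd (snd (the_inv \<psi> f))))"
      by (auto simp: hom arrow_codes_def)
  next
    fix X Y h assume XY: "X \<in> Obj ?C" "Y \<in> Obj ?C"
      and h: "ternary_hom {..<fst (the_inv \<phi> X)} (table_op (the_inv \<phi> X)) {..<fst (the_inv \<phi> Y)}
        (table_op (the_inv \<phi> Y)) h"
    obtain A B where A: "A \<in> algebra_codes" "X = \<phi> A" and B: "B \<in> algebra_codes" "Y = \<phi> B"
      using XY by (auto simp: obj)
    have m: "table_op A x y z < fst A" if "x < fst A" "y < fst A" "z < fst A" for x y z
      using majority_onD(1)[of "{..<fst A}" "table_op A"] A that by (auto simp: algebra_codes_def)
    have "map h [0..<fst A] \<in> arrow_codes A B"
      using h A(2) B(2) m by (auto simp: arrow_codes_def ternary_hom_def)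
    then have "\<psi> (A, B, map h [0..<fst A]) \<in> hom ?C X Y" using A B by (auto simp: hom)
    moreover have "\<forall>x<fst (the_inv \<phi> X). snd (snd (the_inv \<psi> (\<psi> (A, B, map h [0..<fst A])))) ! x = h x"
      using A by simp
    ultimately show "\<exists>f \<in> hom ?C X Y. \<forall>x<fst (the_inv \<phi> X). snd (snd (the_inv \<psi> f)) ! x = h x"
      by blast
  next
    fix f A B g assume "f \<in> hom ?C A B" "g \<in> hom ?C A B"
      "\<And>x. x < fst (the_inv \<phi> A) \<Longrightarrow> snd (snd (the_inv \<psi> f)) ! x = snd (snd (the_inv \<psi> g)) ! x"
    then show "f = g" by (auto simp: hom len intro!: nth_equalityI)
  next
    fix f A B g D x assume "f \<in> hom ?C A B" "g \<in> hom ?C B D" "x < fst (the_inv \<phi> A)"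
    then show "snd (snd (the_inv \<psi> (Comp ?C g f))) ! x =
        snd (snd (the_inv \<psi> g)) ! (snd (snd (the_inv \<psi> f)) ! x)"
      by (auto simp: hom comp len)
  next
    fix A x assume "A \<in> Obj ?C" "x < fst (the_inv \<phi> A)"
    then show "snd (snd (the_inv \<psi> (Ident ?C A))) ! x = x" by (auto simp: obj ident)
  next
    fix d :: nat and m assume m: "majority_on {..<d} m"
    define A where "A = (d, map (\<lambda>x. map (\<lambda>y. map (m x y) [0..<d]) [0..<d]) [0..<d])"
    have t: "table_op A x y z = m x y z" if "x < d" "y < d" "z < d" for x y z
      using that by (simp add: table_op_def A_def)
    have "majority_on {..<d} (table_op A)" using m t by (auto simp: majority_on_def)
    then have "\<phi> A \<in> Obj ?C" by (simp add: obj algebra_codes_def) (simp add: A_def)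
    then show "\<exists>A \<in> Obj ?C. fst (the_inv \<phi> A) = d \<and>
        (\<forall>x<d. \<forall>y<d. \<forall>z<d. table_op (the_inv \<phi> A) x y z = m x y z)"
      using t by (intro bexI[of _ "\<phi> A"]) (auto simp: A_def)
  qed
qed

text \<open>This is where the infinity of the types enters: it provides a copy of
  \<open>nat\<close>, hence room for all codes.\<close>

lemma countable_embeds: "\<exists>f :: 'x::countable \<Rightarrow> 'y::infinite. inj f"
proof -
  obtain g :: "nat \<Rightarrow> 'y" where g: "inj g"
    using infinite_UNIV infinite_iff_countable_subset[of "UNIV :: 'y set"] by blast
  have "inj (\<lambda>x :: 'x. g (to_nat x))" by (rule injI) (simp add: inj_eq[OF g])
  then show ?thesis by blast
qed

lemma Maj_not_implies_reg_Mal: "\<not> implies_reg TYPE('o::infinite \<times> 'a::infinite) Maj Mal"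
proof -
  obtain \<phi> :: "algebra_code \<Rightarrow> 'o" where \<phi>: "inj \<phi>" using countable_embeds ..
  obtain \<psi> :: "arrow_code \<Rightarrow> 'a" where "inj \<psi>" using countable_embeds ..
  with \<phi> interpret majority_algebras "majority_cat \<phi> \<psi>" "\<lambda>A. fst (the_inv \<phi> A)"
    "\<lambda>A. table_op (the_inv \<phi> A)" "\<lambda>f. nth (snd (snd (the_inv \<psi> f)))"
    by (rule majority_algebras_majority_cat)
  show ?thesis
    unfolding implies_reg_def
    using regular_category closed_families_Maj not_closed_families_Mal closed_relations_iff_families
    by blast
qed

lemma implies_reg_trans: "implies_reg T K L \<Longrightarrow> implies_reg T L N \<Longrightarrow> implies_reg T K N"
  by (simp add: implies_reg_def)

theorem corollary3p2:
  fixes M :: "nat mat"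
  assumes "M \<in> matr"
  shows "(implies_reg TYPE('o1::infinite \<times> 'a1::infinite) M Mal \<or>
          implies_reg TYPE('o2::infinite \<times> 'a2::infinite) Maj M) \<and>
         \<not> (implies_reg TYPE('o1 \<times> 'a1) M Mal \<and> implies_reg TYPE('o2 \<times> 'a2) Maj M)"
proof (cases "pairwise_agreeing M")
  case True
  \<comment> \<open>Two instances are needed: the one over the second pair of types is the disjunct,
    and the one over the first composes with the other implication, over the same types, to the
    refuted implication from \<open>Maj\<close> to \<open>Mal\<close>.\<close>
  then have "implies_reg TYPE('o1 \<times> 'a1) Maj M" "implies_reg TYPE('o2 \<times> 'a2) Maj M"
    by (rule implies_reg_Maj)+
  moreover from this(1) have "\<not> implies_reg TYPE('o1 \<times> 'a1) M Mal"
    using implies_reg_trans Maj_not_implies_reg_Mal by metis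
  ultimately show ?thesis by simp
next
  case False
  with assms have "implies_reg TYPE('o1 \<times> 'a1) M Mal" "implies_reg TYPE('o2 \<times> 'a2) M Mal"
    by (rule implies_reg_Mal)+
  moreover from this(2) have "\<not> implies_reg TYPE('o2 \<times> 'a2) Maj M"
    using implies_reg_trans Maj_not_implies_reg_Mal by metis
  ultimately show ?thesis by simp
qed

end
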